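(* Let $M,K,(D_{ij})_{i,j=1}^q,(R_{ij})_{i,j=1}^q$ be as in the context, with the eigenvalues of $P=M^{-1/2}KM^{-1/2}$ pairwise distinct. Then the array $$M\ddot x_i+Kx_i+\sum_{j=1}^q D_{ij}(\dot x_i-\dot x_j)+\sum_{j=1}^q R_{ij}(x_i-x_j)=0,\qquad i=1,\dots,q,$$ synchronizes if and only if $\operatorname{Re}\lambda_{n+1}(\Gamma)>0$, where $\Gamma=L_{\mathrm d}+\mathrm{j}\left([I_q\otimes P]+L_{\mathrm r}\right)\in\mathbb{C}^{qn\times qn}$.
   Context: Let $n\ge 1$ and $q\ge 2$ be integers; $\mathrm{j}$ denotes the imaginary unit and $\otimes$ the Kronecker product. $M,K\in\mathbb{R}^{n\times n}$ are symmetric positive definite. For $i,j\in\{1,\dots,q\}$ the matrices $D_{ij},R_{ij}\in\mathbb{R}^{n\times n}$ are symmetric positive semidefinite with $D_{ij}=D_{ji}$, $R_{ij}=R_{ji}$, $D_{ii}=0$, $R_{ii}=0$. The unknowns are $x_i(t)\in\mathbb{R}^n$. Put $P:=M^{-1/2}KM^{-1/2}$; its eigenvalues $\sigma_1,\dots,\sigma_n>0$ are assumed pairwise distinct. The array synchronizes if $\|x_i(t)-x_j(t)\|\to 0$ as $t\to\infty$ for all $i,j$ and for every solution (all initial conditions). For symmetric positive semidefinite real $n\times n$ matrices $W_{ij}=W_{ji}$ with $W_{ii}=0$, $\mathrm{lap}(W_{ij})_{i,j=1}^q$ denotes the $qn\times qn$ block matrix whose $(i,i)$ block is $\sum_j W_{ij}$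 and whose $(i,j)$ block, $i\ne j$, is $-W_{ij}$. Set $L_{\mathrm d}:=\mathrm{lap}(M^{-1/2}D_{ij}M^{-1/2})_{i,j=1}^q$ and $L_{\mathrm r}:=\mathrm{lap}(M^{-1/2}R_{ij}M^{-1/2})_{i,j=1}^q$. For a square complex matrix $X$, $\lambda_k(X)$ denotes the $k$th smallest eigenvalue with respect to the real part, counted with algebraic multiplicity: $\operatorname{Re}\lambda_1(X)\le\operatorname{Re}\lambda_2(X)\le\cdots$. *)

theory Defs
  imports "HOL-Analysis.Analysis" "HOL-Computational_Algebra.Computational_Algebra"
begin

text \<open>
  Matrices of order \<open>n\<close> are indexed by a finite type \<open>'n\<close>, the nodes of the array by a finite
  type \<open>'q\<close>, and block matrices of order \<open>q n\<close> by \<open>'q \<times> 'n\<close> (block index first).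
\<close>

definition sym_psd :: "real^'n^'n \<Rightarrow> bool" where
  "sym_psd A \<longleftrightarrow> transpose A = A \<and> (\<forall>x. 0 \<le> x \<bullet> (A *v x))"

definition sym_pd :: "real^'n^'n \<Rightarrow> bool" where
  "sym_pd A \<longleftrightarrow> transpose A = A \<and> (\<forall>x. x \<noteq> 0 \<longrightarrow> 0 < x \<bullet> (A *v x))"

definition matrix_sqrt :: "real^'n^'n \<Rightarrow> real^'n^'n" where
  "matrix_sqrt A = (THE S. sym_psd S \<and> S ** S = A)"

definition inv_sqrt :: "real^'n^'n \<Rightarrow> real^'n^'n" where
  "inv_sqrt A = matrix_inv (matrix_sqrt A)"

definition kronecker :: "'a::times^'m^'q \<Rightarrow> 'a^'n^'p \<Rightarrow> 'a^('m \<times> 'n)^('q \<times> 'p)" where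
  "kronecker A B = (\<chi> a b. A $ fst a $ fst b * B $ snd a $ snd b)"

definition lap :: "('q::finite \<Rightarrow> 'q \<Rightarrow> real^'n^'n) \<Rightarrow> real^('q \<times> 'n)^('q \<times> 'n)" where
  "lap W = (\<chi> a b. (if fst a = fst b then \<Sum>j\<in>UNIV. W (fst a) j else - W (fst a) (fst b))
                     $ snd a $ snd b)"

definition charpoly :: "'a::comm_ring_1^'n^'n \<Rightarrow> 'a poly" where
  "charpoly A = det (mat [:0, 1:] - map_matrix (\<lambda>c. [:c:]) A)"

text \<open>The eigenvalues lying in the field \<open>'a\<close>, with algebraic multiplicity.\<close>

definition eigenvalues :: "'a::field^'n^'n \<Rightarrow> 'a multiset" where
  "eigenvalues A = proots (charpoly A)"

text \<open>
  The eigenvalues listed by nondecreasing real part. The order among eigenvalues with equal real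
  part is an arbitrary choice, but the real part of the \<open>k\<close>th entry does not depend on it.
  The index \<open>k\<close> of \<open>eigval_nth\<close> starts at 1.
\<close>

definition eigval_list :: "complex^'n^'n \<Rightarrow> complex list" where
  "eigval_list X = (SOME xs. mset xs = eigenvalues X \<and> sorted (map Re xs))"

definition eigval_nth :: "nat \<Rightarrow> complex^'n^'n \<Rightarrow> complex" where
  "eigval_nth k X = eigval_list X ! (k - 1)"

definition array_solution ::
  "real^'n^'n \<Rightarrow> real^'n^'n \<Rightarrow> ('q::finite \<Rightarrow> 'q \<Rightarrow> real^'n^'n) \<Rightarrow> ('q \<Rightarrow> 'q \<Rightarrow> real^'n^'n)
    \<Rightarrow> ('q \<Rightarrow> real \<Rightarrow> real^'n) \<Rightarrow> bool" where
  "array_solution M K D R x \<longleftrightarrow>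
     (\<exists>x' x''. \<forall>t\<ge>0. \<forall>i.
        (x i has_vector_derivative x' i t) (at t within {0..}) \<and>
        (x' i has_vector_derivative x'' i t) (at t within {0..}) \<and>
        M *v x'' i t + K *v x i t
          + (\<Sum>j\<in>UNIV. D i j *v (x' i t - x' j t))
          + (\<Sum>j\<in>UNIV. R i j *v (x i t - x j t)) = 0)"

definition synchronizes ::
  "real^'n^'n \<Rightarrow> real^'n^'n \<Rightarrow> ('q::finite \<Rightarrow> 'q \<Rightarrow> real^'n^'n) \<Rightarrow> ('q \<Rightarrow> 'q \<Rightarrow> real^'n^'n) \<Rightarrow> bool"
  where
  "synchronizes M K D R \<longleftrightarrow>
     (\<forall>x. array_solution M K D R x \<longrightarrow>
       (\<forall>i j. ((\<lambda>t. norm (x i t - x j t)) \<longlongrightarrow> 0) at_top))"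

definition P_mat :: "real^'n^'n \<Rightarrow> real^'n^'n \<Rightarrow> real^'n^'n" where
  "P_mat M K = inv_sqrt M ** K ** inv_sqrt M"

definition scaled_lap ::
  "real^'n^'n \<Rightarrow> ('q::finite \<Rightarrow> 'q \<Rightarrow> real^'n^'n) \<Rightarrow> real^('q \<times> 'n)^('q \<times> 'n)" where
  "scaled_lap M W = lap (\<lambda>i j. inv_sqrt M ** W i j ** inv_sqrt M)"

definition Gamma_mat ::
  "real^'n^'n \<Rightarrow> real^'n^'n \<Rightarrow> ('q::finite \<Rightarrow> 'q \<Rightarrow> real^'n^'n) \<Rightarrow> ('q \<Rightarrow> 'q \<Rightarrow> real^'n^'n)
    \<Rightarrow> complex^('q \<times> 'n)^('q \<times> 'n)" where
  "Gamma_mat M K D R =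
     map_matrix complex_of_real (scaled_lap M D)
     + map_matrix (\<lambda>r. \<i> * complex_of_real r)
         (kronecker (mat 1 :: real^'q^'q) (P_mat M K) + scaled_lap M R)"

end

theory Submission
  imports Defs
begin

text \<open>
  In the coordinates \<open>y = M\<^sup>1\<^sup>/\<^sup>2 x\<close> the array is the damped oscillator \<open>y'' + A y + B y' = 0\<close> with
  \<open>A = I \<otimes> P + L\<^sub>r\<close> positive definite and \<open>B = L\<^sub>d\<close> positive semidefinite, and \<open>\<Gamma> = B + \<i> A\<close>. Both sides of
  the equivalence say the same about the undamped modes, the eigenvectors of \<open>A\<close> in the kernel of \<open>B\<close>:
  all of them are synchronous, that is, of the form \<open>(u, \<dots>, u)\<close>.

  The averaging projection over the nodes commutes with \<open>A\<close> and satisfies \<open>B avg = avg B = 0\<close>, as both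
  Laplacians vanish on synchronous vectors. It therefore splits every question into one about the
  synchronous subspace and one about the vectors of average zero, and the condition on the modes becomes:
  there is no undamped mode of average zero (\<open>only_synchronous_modes\<close>).

  Spectrum. For an eigenvector \<open>v\<close> of \<open>\<Gamma>\<close> the real part of the eigenvalue is the form of \<open>B\<close> at \<open>v\<close>, up to
  normalisation. All eigenvalues thus have nonnegative real part, and those on the imaginary axis belong
  to the undamped modes. The characteristic polynomial of \<open>\<Gamma>\<close> factors along the splitting
  (\<open>charpoly_commuting_projection\<close>). The factor of the synchronous subspace has degree \<open>n\<close> and only imaginary
  roots, so that the eigenvalue number \<open>n + 1\<close> has positive real part iff the other factor has no
  imaginary root, that is, iff there is no undamped mode of average zero.

  Dynamics. An undamped mode \<open>v\<close> of average zero with \<open>A v = \<omega> v\<close> yields the solution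
  \<open>cos (\<surd>\<omega> t) v\<close>, which does not synchronize. If there is no such mode, then the deviation
  \<open>z = y - avg y\<close> tends to zero (\<open>damped_oscillator_tendsto_0\<close>): its energy decreases, so that \<open>B z'\<close> and with
  it \<open>B A\<^sup>k z'\<close> tend to zero for all \<open>k\<close>, and the common kernel of the matrices \<open>B A\<^sup>k\<close> among the vectors of
  average zero is invariant under \<open>A\<close> and contains no eigenvector of \<open>A\<close>, hence is trivial.

  The change of coordinates needs the unique positive square root of \<open>M\<close>, which comes from the spectral
  theorem for real symmetric matrices.
\<close>

section \<open>The spectral theorem for real symmetric matrices and positive square roots\<close>

lemma symmetric_matrix_inner:
  fixes A :: "real^'n^'n"
  assumes "transpose A = A"
  shows "x \<bullet> (A *v y) = (A *v x) \<bullet> y"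
  by (metis assms dot_lmul_matrix transpose_matrix_vector)

lemma symmetric_matrixI:
  fixes A :: "real^'n^'n"
  assumes "\<And>x y. x \<bullet> (A *v y) = (A *v x) \<bullet> y"
  shows "transpose A = A"
proof -
  have "(transpose A *v x - A *v x) \<bullet> y = 0" for x y
    by (simp add: dot_lmul_matrix assms inner_diff_left)
  then have "transpose A *v x - A *v x = 0" for x
    using inner_eq_zero_iff by blast
  then show ?thesis
    by (simp add: matrix_eq)
qed

lemma linear_coefficient_eq_0_if_quadratic_nonneg:
  fixes b c :: real
  assumes nonneg: "\<And>t. 0 \<le> 2 * t * b + t\<^sup>2 * c"
  shows "b = 0"
proof (rule ccontr)
  assume "b \<noteq> 0"
  \<comment> \<open>At \<open>t = - b / C\<close> the linear term outweighs the quadratic one.\<close>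
  define C where "C = \<bar>c\<bar> + 1"
  have C: "0 < C" "c < C" by (auto simp: C_def)
  have "0 \<le> C\<^sup>2 * (2 * (- b / C) * b + (- b / C)\<^sup>2 * c)"
    by (intro mult_nonneg_nonneg nonneg) simp
  also have "\<dots> = b\<^sup>2 * (c - 2 * C)"
    using C by (simp add: power2_eq_square field_simps)
  also have "\<dots> < 0"
    using C \<open>b \<noteq> 0\<close> by (intro mult_pos_neg) auto
  finally show False by simp
qed

text \<open>
  The Rayleigh quotient attains its maximum \<open>\<omega>\<close> on the unit sphere of \<open>V\<close>, which is compact, at some
  \<open>v\<close>. The form \<open>\<omega>\<bar>x\<bar>\<^sup>2 - x \<bullet> A x\<close> is then nonnegative on \<open>V\<close> and vanishes at \<open>v\<close>, so that its
  derivative at \<open>v\<close> in the direction \<open>\<omega> v - A v\<close>, which lies in \<open>V\<close> by invariance, is zero as well.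
\<close>

lemma symmetric_matrix_eigenvector_in_subspace:
  fixes A :: "real^'n^'n"
  assumes sym: "transpose A = A" and V: "subspace V" "\<And>x. x \<in> V \<Longrightarrow> A *v x \<in> V"
    and ne: "u \<in> V" "u \<noteq> 0"
  obtains v \<omega> where "v \<in> V" "norm v = 1" "A *v v = \<omega> *\<^sub>R v"
proof -
  define S where "S = sphere 0 1 \<inter> V"
  have "compact S"
    unfolding S_def by (intro compact_Int_closed compact_sphere closed_subspace V)
  moreover have "u /\<^sub>R norm u \<in> S"
    using ne V by (auto simp: S_def subspace_scale)
  moreover have "continuous_on S (\<lambda>x. x \<bullet> (A *v x))"
    by (intro continuous_intros matrix_vector_mult_linear_continuous_on)
  ultimately obtain v where v: "v \<in> S" and max: "\<And>x. x \<in> S \<Longrightarrow> x \<bullet> (A *v x) \<le> v \<bullet> (A *v v)"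
    using continuous_attains_sup[of S "\<lambda>x. x \<bullet> (A *v x)"] by blast
  define \<omega> where "\<omega> = v \<bullet> (A *v v)"
  define e where "e = \<omega> *\<^sub>R v - A *v v"
  have vV: "v \<in> V" and nv: "norm v = 1" using v by (auto simp: S_def)
  have eV: "e \<in> V" unfolding e_def using V vV by (intro subspace_diff subspace_scale)
  have nonneg: "0 \<le> \<omega> * (x \<bullet> x) - x \<bullet> (A *v x)" if "x \<in> V" for x
  proof (cases "x = 0")
    case False
    then have "x /\<^sub>R norm x \<in> S" using that V by (auto simp: S_def subspace_scale)
    then have "(x /\<^sub>R norm x) \<bullet> (A *v (x /\<^sub>R norm x)) \<le> \<omega>"
      using max unfolding \<omega>_def by blast
    then have "(x \<bullet> (A *v x)) / (norm x)\<^sup>2 \<le> \<omega>"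
      by (simp add: matrix_vector_mult_scaleR power2_eq_square divide_inverse mult_ac)
    then show ?thesis
      using False by (simp add: field_simps dot_square_norm)
  qed simp
  have "0 \<le> 2 * t * (e \<bullet> e) + t\<^sup>2 * (\<omega> * (e \<bullet> e) - e \<bullet> (A *v e))" for t
  proof -
    have "v + t *\<^sub>R e \<in> V" using V vV eV by (intro subspace_add subspace_scale)
    from nonneg[OF this]
    have "0 \<le> \<omega> * ((v + t *\<^sub>R e) \<bullet> (v + t *\<^sub>R e)) - (v + t *\<^sub>R e) \<bullet> (A *v (v + t *\<^sub>R e))" .
    also have "\<dots> = (\<omega> * (v \<bullet> v) - v \<bullet> (A *v v)) + 2 * t * (e \<bullet> (\<omega> *\<^sub>R v - A *v v))
        + t\<^sup>2 * (\<omega> * (e \<bullet> e) - e \<bullet> (A *v e))"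
      using symmetric_matrix_inner[OF sym, of v e]
      by (simp add: matrix_vector_right_distrib matrix_vector_mult_scaleR inner_add_left
          inner_add_right inner_diff_right algebra_simps power2_eq_square inner_commute)
    also have "\<omega> * (v \<bullet> v) - v \<bullet> (A *v v) = 0"
      using nv by (simp add: \<omega>_def dot_square_norm)
    finally show ?thesis by (simp add: e_def)
  qed
  then have "e \<bullet> e = 0" by (rule linear_coefficient_eq_0_if_quadratic_nonneg)
  then have "A *v v = \<omega> *\<^sub>R v" by (simp add: e_def)
  then show ?thesis using that[OF vV nv] by blast
qed

text \<open>
  An orthonormal set of fewer than \<open>n\<close> eigenvectors can be enlarged, because its orthogonal
  complement is nonzero and invariant under the symmetric matrix.
\<close>

lemma symmetric_matrix_orthonormal_eigenset:
  fixes A :: "real^'n^'n"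
  assumes sym: "transpose A = A" and "k \<le> CARD('n)"
  shows "\<exists>E w. card E = k \<and> finite E \<and> pairwise orthogonal E
      \<and> (\<forall>b\<in>E. norm b = 1 \<and> A *v b = w b *\<^sub>R b)"
  using \<open>k \<le> CARD('n)\<close>
proof (induction k)
  case 0
  show ?case by (rule exI[of _ "{}"]) auto
next
  case (Suc k)
  then obtain E and w :: "real^'n \<Rightarrow> real" where E: "card E = k" "finite E" "pairwise orthogonal E"
      and w: "\<And>b. b \<in> E \<Longrightarrow> norm b = 1 \<and> A *v b = w b *\<^sub>R b"
    by auto
  define V where "V = {y. \<forall>x\<in>E. orthogonal x y}"
  have "dim E < DIM(real^'n)"
    using dim_le_card'[OF E(2)] E(1) Suc.prems by simp
  then obtain u where "u \<noteq> 0" "\<And>y. y \<in> span E \<Longrightarrow> orthogonal u y"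
    using orthogonal_to_subspace_exists by blast
  then have u: "u \<in> V" "u \<noteq> 0"
    by (auto simp: V_def orthogonal_commute span_base)
  have "subspace V" unfolding V_def by (rule subspace_orthogonal_to_vectors)
  moreover have "A *v x \<in> V" if "x \<in> V" for x
    using that w by (auto simp: V_def orthogonal_def symmetric_matrix_inner[OF sym])
  ultimately obtain v \<omega> where v: "v \<in> V" "norm v = 1" "A *v v = \<omega> *\<^sub>R v"
    using symmetric_matrix_eigenvector_in_subspace[OF sym _ _ u] by blast
  have "v \<notin> E" using v by (auto simp: V_def orthogonal_def)
  show ?case
  proof (intro exI conjI ballI)
    show "card (insert v E) = Suc k" "finite (insert v E)" using E \<open>v \<notin> E\<close> by auto
    show "pairwise orthogonal (insert v E)"
      using E(3) v(1) by (auto simp: pairwise_insert V_def orthogonal_commute)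
    fix b assume b: "b \<in> insert v E"
    then show "norm b = 1" using v w by auto
    from b show "A *v b = (w(v := \<omega>)) b *\<^sub>R b" using v w \<open>v \<notin> E\<close> by auto
  qed
qed

lemma symmetric_matrix_orthonormal_eigenbasis:
  fixes A :: "real^'n^'n"
  assumes sym: "transpose A = A"
  obtains E w where "finite E" "pairwise orthogonal E" "span E = UNIV"
    "\<And>b. b \<in> E \<Longrightarrow> norm b = 1" "\<And>b. b \<in> E \<Longrightarrow> A *v b = w b *\<^sub>R b"
proof -
  obtain E w where E: "card E = CARD('n)" "finite E" "pairwise orthogonal E"
      and w: "\<forall>b\<in>E. norm b = 1 \<and> A *v b = w b *\<^sub>R b"
    using symmetric_matrix_orthonormal_eigenset[OF sym order_refl] by auto
  have "0 \<notin> E" using w by auto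
  then have "independent E" using E pairwise_orthogonal_independent by blast
  then have "dim E = DIM(real^'n)" using E by (simp add: dim_eq_card_independent)
  then have "span E = UNIV" using dim_eq_full by blast
  then show thesis using that E w by blast
qed

lemma matrix_eq_on_span:
  fixes A C :: "real^'n^'m"
  assumes "\<And>b. b \<in> E \<Longrightarrow> A *v b = C *v b" and "span E = UNIV"
  shows "A = C"
proof -
  have "A *v x = C *v x" for x
    using linear_eq_on_span[of "(*v) A" "(*v) C" E x] assms by (auto simp: matrix_vector_mul_linear)
  then show ?thesis by (simp add: matrix_eq)
qed

text \<open>The square root scales each vector of an orthonormal eigenbasis by the root of its eigenvalue.\<close>

lemma sym_psd_imp_square:
  fixes A :: "real^'n^'n"
  assumes "sym_psd A"
  obtains S where "sym_psd S" "S ** S = A"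
proof -
  have sym: "transpose A = A" and psd: "\<And>x. 0 \<le> x \<bullet> (A *v x)"
    using assms by (auto simp: sym_psd_def)
  obtain E w where E: "finite E" "pairwise orthogonal E" "span E = UNIV"
      and nrm: "\<And>b. b \<in> E \<Longrightarrow> norm b = 1" and w: "\<And>b. b \<in> E \<Longrightarrow> A *v b = w b *\<^sub>R b"
    using symmetric_matrix_orthonormal_eigenbasis[OF sym] by metis
  have w0: "0 \<le> w b" if "b \<in> E" for b
    using psd[of b] w[OF that] nrm[OF that] by (simp add: dot_square_norm)
  define f where "f = (\<lambda>x. \<Sum>b\<in>E. (sqrt (w b) * (b \<bullet> x)) *\<^sub>R b)"
  define S where "S = matrix f"
  have "linear f"
    unfolding f_def
    by (intro linear_compose_sum ballI linearI) (simp_all add: inner_add_right algebra_simps)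
  then have S: "S *v x = f x" for x
    unfolding S_def by (simp add: matrix_works)
  have inner_S: "x \<bullet> (S *v y) = (\<Sum>b\<in>E. sqrt (w b) * (b \<bullet> x) * (b \<bullet> y))" for x y
    unfolding S f_def by (simp add: inner_sum_right inner_commute mult_ac)
  have "sym_psd S"
    unfolding sym_psd_def
  proof
    show "transpose S = S"
    proof (rule symmetric_matrixI)
      show "x \<bullet> (S *v y) = (S *v x) \<bullet> y" for x y
        by (subst inner_commute[of "S *v x"]) (simp add: inner_S mult_ac)
    qed
    show "\<forall>x. 0 \<le> x \<bullet> (S *v x)"
    proof
      fix x
      have "0 \<le> (\<Sum>b\<in>E. sqrt (w b) * (b \<bullet> x)\<^sup>2)"
        using w0 by (intro sum_nonneg) simp
      then show "0 \<le> x \<bullet> (S *v x)"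
        by (simp add: inner_S power2_eq_square mult.assoc)
    qed
  qed
  moreover have "S ** S = A"
  proof (rule matrix_eq_on_span[OF _ E(3)])
    fix b assume b: "b \<in> E"
    have "(c \<bullet> b) = (if c = b then 1 else 0)" if "c \<in> E" for c
      using that b E(2) nrm by (auto simp: pairwise_def orthogonal_def dot_square_norm)
    then have "S *v b = (\<Sum>c\<in>E. if c = b then sqrt (w c) *\<^sub>R c else 0)"
      unfolding S f_def by (intro sum.cong) auto
    then have "S *v b = sqrt (w b) *\<^sub>R b" using b E(1) by simp
    then show "S ** S *v b = A *v b"
      using w0[OF b] w[OF b]
      by (simp add: matrix_vector_mul_assoc[symmetric] matrix_vector_mult_scaleR)
  qed
  ultimately show thesis by (rule that)
qed

text \<open>
  If \<open>T\<close> is a positive square root of \<open>M\<close> and \<open>T b = \<mu> b\<close>, then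
  \<open>(S + \<mu> I) (S - \<mu> I) b = M b - \<mu>\<^sup>2 b = 0\<close> for every positive square root \<open>S\<close>. As \<open>\<mu> > 0\<close>, the
  first factor is positive definite, so that \<open>S b = \<mu> b\<close>. Hence \<open>S\<close> and \<open>T\<close> agree on an eigenbasis
  of \<open>T\<close>.
\<close>

lemma sym_pd_square_root_unique:
  fixes M :: "real^'n^'n"
  assumes "sym_pd M" and S: "sym_psd S" "S ** S = M" and T: "sym_psd T" "T ** T = M"
  shows "S = T"
proof -
  have sym: "transpose T = T" using T by (simp add: sym_psd_def)
  obtain E w where E: "span E = UNIV" and nrm: "\<And>b. b \<in> E \<Longrightarrow> norm b = 1"
      and w: "\<And>b. b \<in> E \<Longrightarrow> T *v b = w b *\<^sub>R b"
    using symmetric_matrix_orthonormal_eigenbasis[OF sym] by metis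
  show ?thesis
  proof (rule matrix_eq_on_span[OF _ E])
    fix b assume b: "b \<in> E"
    let ?\<mu> = "w b"
    have "0 \<le> ?\<mu>"
      using T(1) w[OF b] nrm[OF b] unfolding sym_psd_def
      by (metis inner_scaleR_right mult.right_neutral norm_eq_1)
    have Mb: "M *v b = ?\<mu>\<^sup>2 *\<^sub>R b"
      unfolding T(2)[symmetric] matrix_vector_mul_assoc[symmetric]
      by (simp add: w[OF b] matrix_vector_mult_scaleR power2_eq_square)
    have "b \<noteq> 0" using nrm[OF b] by auto
    then have "0 < b \<bullet> (M *v b)" using \<open>sym_pd M\<close> by (simp add: sym_pd_def)
    then have "?\<mu> \<noteq> 0" using Mb by auto
    define d where "d = S *v b - ?\<mu> *\<^sub>R b"
    have "S *v d + ?\<mu> *\<^sub>R d = M *v b - ?\<mu>\<^sup>2 *\<^sub>R b"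
      unfolding d_def S(2)[symmetric] matrix_vector_mul_assoc[symmetric]
      by (simp add: matrix_vector_mult_diff_distrib matrix_vector_mult_scaleR power2_eq_square
          algebra_simps)
    then have "d \<bullet> (S *v d) + ?\<mu> * (d \<bullet> d) = 0"
      by (metis Mb diff_self inner_add_right inner_scaleR_right inner_zero_right)
    moreover have "0 \<le> d \<bullet> (S *v d)" using S by (simp add: sym_psd_def)
    moreover have "0 \<le> ?\<mu> * (d \<bullet> d)" using \<open>0 \<le> ?\<mu>\<close> by simp
    ultimately have "?\<mu> * (d \<bullet> d) = 0" by linarith
    then have "d = 0" using \<open>?\<mu> \<noteq> 0\<close> by simp
    then show "S *v b = T *v b" using w[OF b] by (simp add: d_def)
  qed
qed

lemma sym_pd_imp_sym_psd: "sym_pd A \<Longrightarrow> sym_psd A"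
  unfolding sym_pd_def sym_psd_def by (metis inner_zero_left less_eq_real_def)

lemma matrix_sqrt_sym_pd:
  fixes M :: "real^'n^'n"
  assumes "sym_pd M"
  shows "sym_psd (matrix_sqrt M)" "matrix_sqrt M ** matrix_sqrt M = M"
proof -
  obtain S where "sym_psd S" "S ** S = M"
    using sym_psd_imp_square[OF sym_pd_imp_sym_psd[OF assms]] .
  then have "\<exists>!S. sym_psd S \<and> S ** S = M"
    by (metis sym_pd_square_root_unique[OF assms])
  then have "sym_psd (matrix_sqrt M) \<and> matrix_sqrt M ** matrix_sqrt M = M"
    unfolding matrix_sqrt_def by (rule theI')
  then show "sym_psd (matrix_sqrt M)" "matrix_sqrt M ** matrix_sqrt M = M" by auto
qed

lemma sym_pd_kernel: "sym_pd A \<Longrightarrow> A *v x = 0 \<Longrightarrow> x = 0"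
  unfolding sym_pd_def by (metis inner_zero_right order_less_irrefl)

lemma sym_psd_form_zero_imp_kernel:
  fixes A :: "real^'n^'n"
  assumes "sym_psd A" "x \<bullet> (A *v x) = 0"
  shows "A *v x = 0"
proof -
  obtain S where S: "sym_psd S" "S ** S = A" using sym_psd_imp_square[OF assms(1)] .
  then have "(S *v x) \<bullet> (S *v x) = x \<bullet> (A *v x)"
    by (simp add: sym_psd_def symmetric_matrix_inner[symmetric] matrix_vector_mul_assoc)
  then have "S *v x = 0" using assms by simp
  then show ?thesis by (simp add: S(2)[symmetric] matrix_vector_mul_assoc[symmetric])
qed

lemma matrix_sqrt_inv_sqrt:
  fixes M :: "real^'n^'n"
  assumes "sym_pd M"
  shows "matrix_sqrt M ** inv_sqrt M = mat 1" "inv_sqrt M ** matrix_sqrt M = mat 1"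
proof -
  have "x = 0" if "matrix_sqrt M *v x = 0" for x
    using sym_pd_kernel[OF assms, of x] that matrix_sqrt_sym_pd(2)[OF assms]
    by (metis matrix_vector_mul_assoc matrix_vector_mult_0_right)
  then have "invertible (matrix_sqrt M)"
    by (simp add: invertible_left_inverse matrix_left_invertible_ker)
  then have "matrix_sqrt M ** inv_sqrt M = mat 1 \<and> inv_sqrt M ** matrix_sqrt M = mat 1"
    unfolding inv_sqrt_def matrix_inv_def invertible_def by (rule someI_ex)
  then show "matrix_sqrt M ** inv_sqrt M = mat 1" "inv_sqrt M ** matrix_sqrt M = mat 1"
    by auto
qed

lemma inv_sqrt_symmetric:
  fixes M :: "real^'n^'n"
  assumes "sym_pd M"
  shows "transpose (inv_sqrt M) = inv_sqrt M"
proof -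
  let ?S = "matrix_sqrt M" and ?H = "inv_sqrt M"
  have "transpose ?H ** ?S = mat 1"
    using arg_cong[OF matrix_sqrt_inv_sqrt(1)[OF assms], of transpose]
      matrix_sqrt_sym_pd(1)[OF assms]
    by (simp add: matrix_transpose_mul sym_psd_def)
  then have "transpose ?H ** (?S ** ?H) = ?H"
    by (simp add: matrix_mul_assoc)
  then show ?thesis by (simp add: matrix_sqrt_inv_sqrt[OF assms])
qed

lemma inv_sqrt_congruence:
  fixes M :: "real^'n^'n"
  assumes "sym_pd M"
  shows "inv_sqrt M ** M ** inv_sqrt M = mat 1"
proof -
  let ?S = "matrix_sqrt M" and ?H = "inv_sqrt M"
  have "?H ** M ** ?H = (?H ** ?S) ** (?S ** ?H)"
    by (subst matrix_sqrt_sym_pd(2)[OF assms, symmetric]) (simp add: matrix_mul_assoc)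
  then show ?thesis by (simp add: matrix_sqrt_inv_sqrt[OF assms])
qed

section \<open>Characteristic polynomials and invariant splittings\<close>

lemma poly_det: "poly (det A) z = det (map_matrix (\<lambda>p. poly p z) A)"
  by (simp add: det_def poly_sum poly_prod)

lemma poly_charpoly:
  fixes A :: "'a::comm_ring_1^'n^'n"
  shows "poly (charpoly A) z = det (mat z - A)"
proof -
  have "map_matrix (\<lambda>p. poly p z) (mat [:0, 1:] - map_matrix (\<lambda>c. [:c:]) A) = mat z - A"
    by (simp add: vec_eq_iff mat_def)
  then show ?thesis by (simp add: charpoly_def poly_det)
qed

lemma mat_scalar_commute:
  fixes A :: "'a::comm_ring_1^'n^'n"
  shows "A ** mat z = mat z ** A"
  by (simp add: vec_eq_iff matrix_matrix_mult_def mat_def if_distrib if_distribR mult.commute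
      cong: if_cong)

lemma mat_mult_vector:
  fixes v :: "'a::comm_ring_1^'n"
  shows "mat z *v v = z *s v"
  by (simp add: vec_eq_iff matrix_vector_mult_def mat_def if_distrib if_distribR cong: if_cong)

lemma matrix_mult_diff_distrib:
  fixes A B C :: "'a::comm_ring_1^'n^'n"
  shows "A ** (B - C) = A ** B - A ** C" "(B - C) ** A = B ** A - C ** A"
  by (simp_all add: vec_eq_iff matrix_matrix_mult_def algebra_simps sum_subtractf)

lemma matrix_mult_add_rdistrib:
  fixes X Y :: "'a::semiring_1^'n^'m"
  shows "(X + Y) ** Z = X ** Z + Y ** Z"
  by (simp add: vec_eq_iff matrix_matrix_mult_def sum.distrib distrib_right)

lemma charpoly_similar:
  fixes A T Ti :: "complex^'n^'n"
  assumes "Ti ** T = mat 1"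
  shows "charpoly (T ** A ** Ti) = charpoly A"
proof -
  have TTi: "T ** Ti = mat 1" using assms by (rule matrix_left_right_inverse1)
  have "poly (charpoly (T ** A ** Ti)) z = poly (charpoly A) z" for z
  proof -
    have "T ** mat z ** Ti = mat z ** (T ** Ti)"
      by (simp only: mat_scalar_commute matrix_mul_assoc)
    then have "T ** mat z ** Ti = mat z"
      by (simp add: TTi)
    then have "mat z - T ** A ** Ti = T ** (mat z - A) ** Ti"
      by (simp add: matrix_mult_diff_distrib)
    moreover have "det T * det Ti = 1" by (simp add: TTi flip: det_mul)
    ultimately show ?thesis by (simp add: poly_charpoly det_mul)
  qed
  then show ?thesis by (simp add: poly_eq_poly_eq_iff[symmetric] fun_eq_iff)
qed

lemma degree_det_summand_le:
  fixes A :: "'a::idom poly^'n^'n"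
  assumes "\<And>i. degree (A $ i $ p i) \<le> d i"
  shows "degree (of_int (sign p) * (\<Prod>i\<in>UNIV. A $ i $ p i)) \<le> sum d UNIV"
proof -
  have "degree (of_int (sign p) * (\<Prod>i\<in>UNIV. A $ i $ p i)) \<le> degree (\<Prod>i\<in>UNIV. A $ i $ p i)"
    by (simp add: sign_def)
  also have "\<dots> \<le> (\<Sum>i\<in>UNIV. degree (A $ i $ p i))"
    using degree_prod_sum_le[of UNIV "\<lambda>i. A $ i $ p i"] by simp
  also have "\<dots> \<le> sum d UNIV" by (intro sum_mono assms)
  finally show ?thesis .
qed

lemma degree_det_le:
  fixes A :: "'a::idom poly^'n^'n"
  assumes "\<And>i j. degree (A $ i $ j) \<le> d i"
  shows "degree (det A) \<le> sum d UNIV"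
  unfolding det_def by (intro degree_sum_le degree_det_summand_le assms) (simp add: finite_permutations)

text \<open>
  Only the identity permutation takes all \<open>n\<close> factors from the diagonal, where the indeterminate
  stands; every other summand of the determinant has smaller degree.
\<close>

lemma degree_charpoly:
  fixes A :: "'a::idom^'n^'n"
  shows "degree (charpoly A) = CARD('n)"
proof -
  define C where "C = mat [:0, 1:] - map_matrix (\<lambda>c. [:c:]) A"
  define f where "f p = of_int (sign p) * (\<Prod>i\<in>UNIV. C $ i $ p i)" for p
  have C: "C $ i $ j = (if i = j then [:- A $ i $ i, 1:] else [:- A $ i $ j:])" for i j
    by (simp add: C_def mat_def)
  have fin: "finite {p. p permutes (UNIV::'n set)}" by (simp add: finite_permutations)
  have "degree (f id) = CARD('n)"
    by (simp add: f_def C degree_prod_eq_sum_degree)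
  moreover have "degree (f p) < CARD('n)" if "p \<noteq> id" for p
  proof -
    have "degree (f p) \<le> (\<Sum>i\<in>UNIV. if p i = i then 1 else 0)"
      unfolding f_def by (rule degree_det_summand_le) (simp add: C)
    also have "\<dots> < (\<Sum>i\<in>(UNIV::'n set). 1)"
      using that by (intro sum_strict_mono_ex1) (auto simp: fun_eq_iff)
    finally show ?thesis by simp
  qed
  then have "degree (\<Sum>p\<in>{p. p permutes UNIV} - {id}. f p) < CARD('n)"
    by (intro degree_sum_less) auto
  moreover have "charpoly A = f id + (\<Sum>p\<in>{p. p permutes UNIV} - {id}. f p)"
    unfolding charpoly_def C_def[symmetric] det_def f_def[symmetric]
    by (intro sum.remove fin) (simp add: permutes_id)
  ultimately show ?thesis by (simp add: degree_add_eq_left)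
qed

lemma det_eq_0_iff_kernel:
  fixes A :: "'a::field^'n^'n"
  shows "det A = 0 \<longleftrightarrow> (\<exists>v. v \<noteq> 0 \<and> A *v v = 0)"
  by (metis invertible_det_nz invertible_left_inverse matrix_left_invertible_ker)

text \<open>
  The diagonal block of \<open>C\<close> with rows and columns in \<open>U\<close>, extended by an identity block: this keeps
  the determinant of the block but makes it a matrix over the full index type.
\<close>

definition pad_block :: "'n set \<Rightarrow> 'a::zero_neq_one^'n^'n \<Rightarrow> 'a^'n^'n" where
  "pad_block U C = (\<chi> a b. if a \<in> U \<and> b \<in> U then C $ a $ b else if a = b then 1 else 0)"

lemma pad_block_mult:
  fixes C :: "'a::comm_ring_1^'n^'n"
  assumes "\<And>a b. (a \<in> U) \<noteq> (b \<in> U) \<Longrightarrow> C $ a $ b = 0"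
  shows "pad_block U C ** pad_block (- U) C = C"
proof -
  have "(\<Sum>k\<in>UNIV. pad_block U C $ a $ k * pad_block (- U) C $ k $ b) = C $ a $ b" for a b
  proof (cases "a \<in> U")
    case True
    then have "pad_block U C $ a $ k * pad_block (- U) C $ k $ b
        = (if k = b then C $ a $ b else 0)" for k
      using assms[of a b] by (auto simp: pad_block_def)
    then show ?thesis by simp
  next
    case False
    then have "pad_block U C $ a $ k * pad_block (- U) C $ k $ b
        = (if k = a then C $ a $ b else 0)" for k
      using assms[of a b] by (auto simp: pad_block_def)
    then show ?thesis by simp
  qed
  then show ?thesis by (simp add: vec_eq_iff matrix_matrix_mult_def)
qed

lemma pad_block_kernel:
  fixes C :: "'a::comm_ring_1^'n^'n"
  assumes "\<And>a b. (a \<in> U) \<noteq> (b \<in> U) \<Longrightarrow> C $ a $ b = 0"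
  shows "pad_block U C *v v = 0 \<longleftrightarrow> (\<forall>a. a \<notin> U \<longrightarrow> v $ a = 0) \<and> C *v v = 0"
proof -
  have out: "(pad_block U C *v v) $ a = v $ a" if "a \<notin> U" for a
  proof -
    have "pad_block U C $ a $ k * v $ k = (if k = a then v $ a else 0)" for k
      using that by (simp add: pad_block_def)
    then show ?thesis by (simp add: matrix_vector_mult_def)
  qed
  have inside: "(pad_block U C *v v) $ a = (C *v v) $ a" if "a \<in> U" for a
    unfolding matrix_vector_mult_def vec_lambda_beta
  proof (rule sum.cong)
    fix b
    show "pad_block U C $ a $ b * v $ b = C $ a $ b * v $ b"
      using that assms[of a b] by (cases "b \<in> U") (auto simp: pad_block_def)
  qed simp
  have mixed: "(C *v v) $ a = 0" if "a \<notin> U" "\<And>b. b \<notin> U \<Longrightarrow> v $ b = 0" for a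
    unfolding matrix_vector_mult_def vec_lambda_beta
  proof (rule sum.neutral, rule ballI)
    fix b
    show "C $ a $ b * v $ b = 0" using that assms[of a b] by (cases "b \<in> U") auto
  qed
  show ?thesis
  proof (intro iffI conjI allI impI)
    assume L: "pad_block U C *v v = 0"
    then show off: "v $ a = 0" if "a \<notin> U" for a using out[OF that] by simp
    have "(C *v v) $ a = 0" for a
      using L inside[of a] mixed[OF _ off, of a] by (cases "a \<in> U") auto
    then show "C *v v = 0" by (simp add: vec_eq_iff)
  next
    assume R: "(\<forall>a. a \<notin> U \<longrightarrow> v $ a = 0) \<and> C *v v = 0"
    have "(pad_block U C *v v) $ a = 0" for a
      using R out[of a] inside[of a] by (cases "a \<in> U") auto
    then show "pad_block U C *v v = 0" by (simp add: vec_eq_iff)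
  qed
qed

lemma degree_det_pad_block_le:
  fixes C :: "'a::idom poly^'n^'n"
  assumes "\<And>i j. degree (C $ i $ j) \<le> 1"
  shows "degree (det (pad_block U C)) \<le> card U"
proof -
  have "degree (det (pad_block U C)) \<le> (\<Sum>a\<in>UNIV. if a \<in> U then 1 else 0)"
    using assms by (intro degree_det_le) (auto simp: pad_block_def)
  then show ?thesis by (simp add: sum.If_cases)
qed

text \<open>
  The determinant of a padded block has degree at most the size of the block, and the two bounds
  add up to the degree of the product, which is why both are attained.
\<close>

lemma charpoly_block_diagonal:
  fixes G :: "'a::field^'n^'n"
  assumes blocks: "\<And>a b. (a \<in> U) \<noteq> (b \<in> U) \<Longrightarrow> G $ a $ b = 0"
  obtains p r where "charpoly G = p * r" "degree p = card U"
    "\<forall>z. poly p z = 0 \<longleftrightarrow> (\<exists>w. w \<noteq> 0 \<and> (\<forall>a. a \<notin> U \<longrightarrow> w $ a = 0) \<and> G *v w = z *s w)"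
    "\<forall>z. poly r z = 0 \<longleftrightarrow> (\<exists>w. w \<noteq> 0 \<and> (\<forall>a. a \<in> U \<longrightarrow> w $ a = 0) \<and> G *v w = z *s w)"
proof -
  define C where "C = mat [:0, 1:] - map_matrix (\<lambda>c. [:c:]) G"
  have C0: "C $ a $ b = 0" if "(a \<in> U) \<noteq> (b \<in> U)" for a b
    using that blocks[OF that] by (auto simp: C_def mat_def)
  have C1: "degree (C $ a $ b) \<le> 1" for a b
    by (simp add: C_def mat_def)
  define p r where "p = det (pad_block U C)" and "r = det (pad_block (- U) C)"
  have pr: "charpoly G = p * r"
    unfolding p_def r_def det_mul[symmetric] by (simp add: pad_block_mult C0 charpoly_def C_def[symmetric])
  have "charpoly G \<noteq> 0" using degree_charpoly[of G] by auto
  then have "degree p + degree r = CARD('n)"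
    using degree_charpoly[of G] by (simp add: pr degree_mult_eq)
  moreover have "card U + card (- U) = CARD('n)"
    by (simp add: Compl_eq_Diff_UNIV card_Diff_subset card_mono)
  moreover have "degree p \<le> card U" "degree r \<le> card (- U)"
    unfolding p_def r_def by (intro degree_det_pad_block_le C1)+
  ultimately have deg: "degree p = card U" by linarith
  have root: "poly (det (pad_block V C)) z = 0
      \<longleftrightarrow> (\<exists>w. w \<noteq> 0 \<and> (\<forall>a. a \<notin> V \<longrightarrow> w $ a = 0) \<and> G *v w = z *s w)"
    if V: "\<And>a b. (a \<in> V) \<noteq> (b \<in> V) \<Longrightarrow> (a \<in> U) \<noteq> (b \<in> U)" for V z
  proof -
    have off: "(mat z - G) $ a $ b = 0" if "(a \<in> V) \<noteq> (b \<in> V)" for a b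
      using blocks[OF V[OF that]] that by (auto simp: mat_def)
    have "(mat z - G) *v w = 0 \<longleftrightarrow> G *v w = z *s w" for w
      by (auto simp: matrix_vector_mult_diff_rdistrib mat_mult_vector)
    then have "pad_block V (mat z - G) *v w = 0 \<longleftrightarrow> (\<forall>a. a \<notin> V \<longrightarrow> w $ a = 0) \<and> G *v w = z *s w" for w
      using pad_block_kernel[OF off, of V w] by blast
    moreover have "map_matrix (\<lambda>p. poly p z) (pad_block V C) = pad_block V (mat z - G)"
      by (simp add: vec_eq_iff pad_block_def C_def mat_def)
    ultimately show ?thesis by (simp only: poly_det det_eq_0_iff_kernel)
  qed
  show thesis
    by (rule that[OF pr deg]) (use root[of U] root[of "- U"] in \<open>simp_all add: p_def r_def\<close>)
qed

text \<open>
  A matrix commuting with a projection \<open>E\<close> is block diagonal in coordinates given by \<open>T\<close> in which \<open>E\<close>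
  is the coordinate projection onto \<open>U\<close>. The factors \<open>p\<close> and \<open>r\<close> are the characteristic polynomials of
  \<open>G\<close> on the range and on the kernel of \<open>E\<close>.
\<close>

lemma charpoly_commuting_projection:
  fixes G E T Ti :: "complex^'n^'n"
  assumes comm: "E ** G = G ** E" and Ti: "Ti ** T = mat 1"
    and T: "T ** E = (\<chi> a b. if a \<in> U then T $ a $ b else 0)"
  obtains p r where "charpoly G = p * r" "degree p = card U"
    "\<forall>z. poly p z = 0 \<longleftrightarrow> (\<exists>v. v \<noteq> 0 \<and> E *v v = v \<and> G *v v = z *s v)"
    "\<forall>z. poly r z = 0 \<longleftrightarrow> (\<exists>v. v \<noteq> 0 \<and> E *v v = 0 \<and> G *v v = z *s v)"
proof -
  have TTi: "T ** Ti = mat 1" using Ti by (rule matrix_left_right_inverse1)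
  have [simp]: "Ti *v (T *v v) = v" "T *v (Ti *v v) = v" for v
    by (simp_all add: matrix_vector_mul_assoc Ti TTi)
  have TE: "(T *v (E *v v)) $ a = (if a \<in> U then (T *v v) $ a else 0)" for v a
    by (simp add: matrix_vector_mul_assoc T) (simp add: matrix_vector_mult_def)
  have Teq: "T *v v = T *v w \<longleftrightarrow> v = w" for v w
    by (metis \<open>\<And>v. Ti *v (T *v v) = v\<close>)
  define G' where "G' = T ** G ** Ti"
  have G': "G' *v (T *v v) = T *v (G *v v)" for v
    by (simp add: G'_def flip: matrix_vector_mul_assoc)
  have EG: "E *v (G *v v) = G *v (E *v v)" for v
    by (simp add: matrix_vector_mul_assoc comm)
  have proj: "(if a \<in> U then (G' *v w) $ a else 0) = (G' *v (\<chi> b. if b \<in> U then w $ b else 0)) $ a" for a w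
  proof -
    have "(\<chi> b. if b \<in> U then w $ b else 0) = T *v (E *v (Ti *v w))"
      by (simp add: vec_eq_iff TE)
    then have "G' *v (\<chi> b. if b \<in> U then w $ b else 0) = T *v (E *v (G *v (Ti *v w)))"
      by (simp add: G' EG)
    moreover have "T *v (G *v (Ti *v w)) = G' *v w"
      using G'[of "Ti *v w"] by simp
    ultimately show ?thesis by (simp add: TE)
  qed
  have "G' $ a $ b = 0" if "(a \<in> U) \<noteq> (b \<in> U)" for a b
  proof -
    have "G' *v axis b 1 = (\<chi> i. G' $ i $ b)"
      by (simp add: vec_eq_iff matrix_vector_mult_def axis_def if_distrib cong: if_cong)
    moreover have "(\<chi> c. if c \<in> U then (axis b 1 :: complex^'n) $ c else 0) = (if b \<in> U then axis b 1 else 0)"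
      by (auto simp: vec_eq_iff axis_def)
    ultimately show ?thesis
      using proj[of a "axis b 1"] that by (auto split: if_splits)
  qed
  then obtain p r where pr: "charpoly G' = p * r" "degree p = card U"
    and p: "\<forall>z. poly p z = 0 \<longleftrightarrow> (\<exists>w. w \<noteq> 0 \<and> (\<forall>a. a \<notin> U \<longrightarrow> w $ a = 0) \<and> G' *v w = z *s w)"
    and r: "\<forall>z. poly r z = 0 \<longleftrightarrow> (\<exists>w. w \<noteq> 0 \<and> (\<forall>a. a \<in> U \<longrightarrow> w $ a = 0) \<and> G' *v w = z *s w)"
    using charpoly_block_diagonal[of U G'] by blast
  have transport: "(\<exists>w. w \<noteq> 0 \<and> P w \<and> G' *v w = z *s w) \<longleftrightarrow> (\<exists>v. v \<noteq> 0 \<and> P (T *v v) \<and> G *v v = z *s v)" for P z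
  proof -
    have "(\<exists>w. w \<noteq> 0 \<and> P w \<and> G' *v w = z *s w)
        \<longleftrightarrow> (\<exists>v. T *v v \<noteq> 0 \<and> P (T *v v) \<and> G' *v (T *v v) = z *s (T *v v))"
      by (metis \<open>\<And>v. T *v (Ti *v v) = v\<close>)
    also have "\<dots> \<longleftrightarrow> (\<exists>v. v \<noteq> 0 \<and> P (T *v v) \<and> G *v v = z *s v)"
      by (metis G' Teq matrix_vector_mult_0_right vector_scalar_commute)
    finally show ?thesis .
  qed
  have range: "(\<forall>a. a \<notin> U \<longrightarrow> (T *v v) $ a = 0) \<longleftrightarrow> E *v v = v" for v
    unfolding Teq[of "E *v v" v, symmetric] by (auto simp: vec_eq_iff TE)
  have kernel: "(\<forall>a. a \<in> U \<longrightarrow> (T *v v) $ a = 0) \<longleftrightarrow> E *v v = 0" for v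
    unfolding Teq[of "E *v v" 0, symmetric] by (auto simp: vec_eq_iff TE)
  show thesis
  proof (rule that)
    show "charpoly G = p * r"
      using pr(1) charpoly_similar[OF Ti, of G] by (simp add: G'_def)
  qed (simp_all add: pr p r transport range kernel)
qed

section \<open>The eigenvalue list ordered by real part\<close>

text \<open>In a sorted list the entries that are at most \<open>c\<close> form an initial segment.\<close>

lemma sorted_nth_gt_iff:
  fixes ys :: "'a::linorder list"
  assumes "sorted ys" "k < length ys"
  shows "c < ys ! k \<longleftrightarrow> length (filter (\<lambda>y. y \<le> c) ys) \<le> k"
proof -
  define I where "I = {i. i < length ys \<and> ys ! i \<le> c}"
  have I: "length (filter (\<lambda>y. y \<le> c) ys) = card I" "finite I"
    by (simp_all add: I_def length_filter_conv_card)
  show ?thesis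
  proof
    assume "c < ys ! k"
    then have "i < k" if "i \<in> I" for i
      using that sorted_nth_mono[OF assms(1), of k i] by (fastforce simp: I_def not_less[symmetric])
    then have "I \<subseteq> {..<k}" by auto
    from card_mono[OF _ this] show "length (filter (\<lambda>y. y \<le> c) ys) \<le> k" by (simp add: I)
  next
    assume le: "length (filter (\<lambda>y. y \<le> c) ys) \<le> k"
    show "c < ys ! k"
    proof (rule ccontr)
      assume "\<not> c < ys ! k"
      then have "i \<in> I" if "i \<le> k" for i
        using that assms(2) sorted_nth_mono[OF assms(1) that assms(2)] by (auto simp: I_def)
      then have "{..k} \<subseteq> I" by auto
      from card_mono[OF I(2) this] show False using le by (simp add: I)
    qed
  qed
qed

text \<open>The choice in the definition has a solution: sort any list of the eigenvalues.\<close>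

lemma eigval_list:
  "mset (eigval_list X) = eigenvalues X" "sorted (map Re (eigval_list X))"
proof -
  obtain xs where "mset xs = eigenvalues X" using ex_mset by blast
  then have "mset (sort_key Re xs) = eigenvalues X \<and> sorted (map Re (sort_key Re xs))"
    by simp
  then have "mset (eigval_list X) = eigenvalues X \<and> sorted (map Re (eigval_list X))"
    unfolding eigval_list_def by (rule someI)
  then show "mset (eigval_list X) = eigenvalues X" "sorted (map Re (eigval_list X))"
    by auto
qed

lemma Re_eigval_nth_pos_iff:
  fixes X :: "complex^'n^'n"
  assumes "k < CARD('n)"
  shows "0 < Re (eigval_nth (k + 1) X) \<longleftrightarrow> size {#z \<in># eigenvalues X. Re z \<le> 0#} \<le> k"
proof -
  let ?xs = "eigval_list X"
  have "length ?xs = CARD('n)"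
    by (metis degree_charpoly eigenvalues_def eigval_list(1) size_mset size_proots_complex)
  then have "0 < Re (eigval_nth (k + 1) X) \<longleftrightarrow> length (filter (\<lambda>y. y \<le> 0) (map Re ?xs)) \<le> k"
    using sorted_nth_gt_iff[OF eigval_list(2)[of X], of k 0] assms by (simp add: eigval_nth_def)
  also have "length (filter (\<lambda>y. y \<le> 0) (map Re ?xs)) = size {#z \<in># eigenvalues X. Re z \<le> 0#}"
    by (simp add: filter_map o_def flip: eigval_list(1) mset_filter)
  finally show ?thesis .
qed

section \<open>Asymptotics of damped oscillators\<close>

text \<open>
  A bounded second derivative makes the difference quotients \<open>(f (t + h) - f t) / h\<close> uniformly close
  to \<open>f' t\<close> for small \<open>h\<close>, and for fixed \<open>h\<close> they tend to zero.
\<close>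

lemma derivative_tendsto_0:
  fixes f :: "real \<Rightarrow> 'a::real_normed_vector"
  assumes f: "\<And>t. 0 \<le> t \<Longrightarrow> (f has_vector_derivative f' t) (at t within {0..})"
    and f': "\<And>t. 0 \<le> t \<Longrightarrow> (f' has_vector_derivative f'' t) (at t within {0..})"
    and bdd: "bounded (f'' ` {0..})" and lim: "(f \<longlongrightarrow> c) at_top"
  shows "(f' \<longlongrightarrow> 0) at_top"
proof (rule tendstoI)
  fix \<epsilon> :: real assume "0 < \<epsilon>"
  obtain B where "0 < B" and B: "\<And>t. 0 \<le> t \<Longrightarrow> norm (f'' t) \<le> B"
    using bdd unfolding bounded_pos by auto
  have lip: "norm (f' x - f' y) \<le> B * norm (x - y)" if "0 \<le> x" "0 \<le> y" for x y
  proof (rule differentiable_bound[of "{0..}" f' "\<lambda>t h. h *\<^sub>R f'' t"])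
    fix t :: real assume "t \<in> {0..}"
    then show "(f' has_derivative (\<lambda>h. h *\<^sub>R f'' t)) (at t within {0..})"
      using f' by (simp add: has_vector_derivative_def)
    show "onorm (\<lambda>h. h *\<^sub>R f'' t) \<le> B"
      using B \<open>t \<in> {0..}\<close> by (intro onorm_le) (simp add: mult.commute[of B] mult_left_mono)
  qed (use that in auto)
  \<comment> \<open>The error \<open>B * h\<close> of the difference quotient is then \<open>\<epsilon> / 2\<close>.\<close>
  define h where "h = \<epsilon> / (2 * B)"
  have "0 < h" using \<open>0 < B\<close> \<open>0 < \<epsilon>\<close> by (simp add: h_def)
  have quotient: "norm (f (t + h) - f t - h *\<^sub>R f' t) \<le> h * (B * h)" if "0 \<le> t" for t
  proof -
    have "norm (f (t + h) - f t - (t + h - t) *\<^sub>R f' t) \<le> norm (t + h - t) * (B * h)"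
    proof (rule vector_differentiable_bound_linearization[of "{t..t + h}" f f'])
      fix x assume x: "x \<in> {t..t + h}"
      show "(f has_vector_derivative f' x) (at x within {t..t + h})"
        using x that by (intro has_vector_derivative_within_subset[OF f]) auto
      have "norm (f' x - f' t) \<le> B * norm (x - t)" using x that by (intro lip) auto
      also have "\<dots> \<le> B * h" using x \<open>0 < B\<close> by (intro mult_left_mono) auto
      finally show "norm (f' x - f' t) \<le> B * h" .
    qed (use \<open>0 < h\<close> in \<open>auto simp: closed_segment_eq_real_ivl\<close>)
    then show ?thesis using \<open>0 < h\<close> by simp
  qed
  have "eventually (\<lambda>t. dist (f t) c < h * \<epsilon> / 4) at_top"
    using \<open>0 < h\<close> \<open>0 < \<epsilon>\<close> by (intro tendstoD[OF lim]) simp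
  then obtain N where N: "\<And>t. N \<le> t \<Longrightarrow> dist (f t) c < h * \<epsilon> / 4"
    unfolding eventually_at_top_linorder by blast
  have "dist (f' t) 0 < \<epsilon>" if "max N 0 \<le> t" for t
  proof -
    have "norm (h *\<^sub>R f' t) \<le> norm (f (t + h) - f t) + norm (f (t + h) - f t - h *\<^sub>R f' t)"
      by (metis norm_minus_commute norm_triangle_sub)
    also have "norm (f (t + h) - f t) \<le> dist (f (t + h)) c + dist (f t) c"
      by (simp add: dist_norm[symmetric] dist_triangle2)
    also have "\<dots> < h * \<epsilon> / 4 + h * \<epsilon> / 4"
      using that \<open>0 < h\<close> by (intro add_strict_mono N) auto
    also have "norm (f (t + h) - f t - h *\<^sub>R f' t) \<le> h * (B * h)"
      using that by (intro quotient) simp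
    also have "B * h = \<epsilon> / 2" using \<open>0 < B\<close> by (simp add: h_def)
    finally have "h * norm (f' t) < h * \<epsilon>" using \<open>0 < h\<close> by simp
    then show ?thesis using \<open>0 < h\<close> by simp
  qed
  then show "eventually (\<lambda>t. dist (f' t) 0 < \<epsilon>) at_top"
    unfolding eventually_at_top_linorder by blast
qed

lemma tendsto_matrix_vector_mult:
  fixes C :: "real^'n^'m"
  shows "(f \<longlongrightarrow> l) F \<Longrightarrow> ((\<lambda>t. C *v f t) \<longlongrightarrow> C *v l) F"
  by (rule bounded_linear.tendsto[OF matrix_vector_mul_bounded_linear])

lemma has_vector_derivative_matrix_vector_mult:
  fixes C :: "real^'n^'m"
  shows "(f has_vector_derivative f') F \<Longrightarrow> ((\<lambda>t. C *v f t) has_vector_derivative C *v f') F"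
  by (rule bounded_linear.has_vector_derivative[OF matrix_vector_mul_bounded_linear])

lemma bounded_matrix_vector_mult:
  fixes C :: "real^'n^'m"
  assumes "bounded (f ` S)"
  shows "bounded ((\<lambda>t. C *v f t) ` S)"
  using bounded_linear_image[OF assms matrix_vector_mul_bounded_linear[of C]]
  by (simp add: image_image)

lemma bounded_uminus_comp:
  fixes f :: "'b \<Rightarrow> 'a::real_normed_vector"
  shows "bounded (f ` S) \<Longrightarrow> bounded ((\<lambda>t. - f t) ` S)"
  by (simp add: bounded_iff)

lemma nonincreasing_nonneg_tendsto:
  fixes e :: "real \<Rightarrow> real"
  assumes anti: "\<And>s t. 0 \<le> s \<Longrightarrow> s \<le> t \<Longrightarrow> e t \<le> e s" and nonneg: "\<And>t. 0 \<le> t \<Longrightarrow> 0 \<le> e t"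
  shows "(e \<longlongrightarrow> Inf (e ` {0..})) at_top"
proof (rule decreasing_tendsto)
  have bb: "bdd_below (e ` {0..})" using nonneg by (intro bdd_belowI[of _ 0]) auto
  show "eventually (\<lambda>t. Inf (e ` {0..}) \<le> e t) at_top"
    unfolding eventually_at_top_linorder using bb by (auto intro!: exI[of _ 0] cInf_lower)
  fix x assume "Inf (e ` {0..}) < x"
  then obtain s where "0 \<le> s" "e s < x"
    using bb by (auto simp: cInf_less_iff)
  then show "eventually (\<lambda>t. e t < x) at_top"
    unfolding eventually_at_top_linorder using anti by (meson le_less_trans)
qed

text \<open>
  The energy \<open>\<bar>z'\<bar>\<^sup>2 + z \<bullet> A z\<close> has derivative \<open>- 2 (z' \<bullet> B z')\<close>. It therefore converges, all
  derivatives of the solution are bounded, and so \<open>B z' \<rightarrow> 0\<close>. If \<open>C z' \<rightarrow> 0\<close> for some matrix \<open>C\<close>,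
  then the derivatives of \<open>C z'\<close> tend to zero as well, in particular
  \<open>C z''' = - C A z' - C B z''\<close>, whence \<open>C A z' \<rightarrow> 0\<close>. By induction \<open>B A\<^sup>k z' \<rightarrow> 0\<close> for all \<open>k\<close>, so
  that every limit point of \<open>z'\<close> lies in the intersection of \<open>W\<close> and the kernels of all \<open>B A\<^sup>k\<close>. This
  intersection is invariant under \<open>A\<close>; were it nonzero, it would contain an eigenvector of \<open>A\<close> on
  which \<open>B\<close> vanishes.
\<close>

lemma damped_oscillator_tendsto_0:
  fixes A B :: "real^'m^'m" and z z' :: "real \<Rightarrow> real^'m"
  assumes A: "sym_pd A" and B: "sym_psd B"
    and W: "subspace W" "\<And>w. w \<in> W \<Longrightarrow> A *v w \<in> W"
    and undamped: "\<And>v \<omega>. v \<in> W \<Longrightarrow> A *v v = \<omega> *\<^sub>R v \<Longrightarrow> B *v v = 0 \<Longrightarrow> v = 0"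
    and dz: "\<And>t. 0 \<le> t \<Longrightarrow> (z has_vector_derivative z' t) (at t within {0..})"
    and dz': "\<And>t. 0 \<le> t \<Longrightarrow>
      (z' has_vector_derivative - (A *v z t) - B *v z' t) (at t within {0..})"
    and z'W: "\<And>t. 0 \<le> t \<Longrightarrow> z' t \<in> W"
  shows "(z \<longlongrightarrow> 0) at_top"
proof -
  \<comment> \<open>\<open>z2\<close>, \<open>z3\<close> and \<open>z4\<close> are the second, third and fourth derivative of \<open>z\<close>.\<close>
  define z2 where "z2 t = - (A *v z t) - B *v z' t" for t
  define z3 where "z3 t = - (A *v z' t) - B *v z2 t" for t
  define z4 where "z4 t = - (A *v z2 t) - B *v z3 t" for t
  have d1: "(z' has_vector_derivative z2 t) (at t within {0..})" if "0 \<le> t" for t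
    using dz'[OF that] by (simp add: z2_def)
  have d2: "(z2 has_vector_derivative z3 t) (at t within {0..})" if "0 \<le> t" for t
  proof -
    have "((\<lambda>t. - (A *v z t) - B *v z' t) has_vector_derivative - (A *v z' t) - B *v z2 t)
        (at t within {0..})"
      by (intro has_vector_derivative_diff has_vector_derivative_minus
          has_vector_derivative_matrix_vector_mult dz d1 that)
    then show ?thesis by (simp only: z2_def[abs_def] z3_def)
  qed
  have d3: "(z3 has_vector_derivative z4 t) (at t within {0..})" if "0 \<le> t" for t
  proof -
    have "((\<lambda>t. - (A *v z' t) - B *v z2 t) has_vector_derivative - (A *v z2 t) - B *v z3 t)
        (at t within {0..})"
      by (intro has_vector_derivative_diff has_vector_derivative_minus
          has_vector_derivative_matrix_vector_mult d1 d2 that)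
    then show ?thesis by (simp only: z3_def[abs_def] z4_def)
  qed
  have symA: "transpose A = A" and symB: "transpose B = B" and psdB: "0 \<le> x \<bullet> (B *v x)" for x
    using A B by (auto simp: sym_pd_def sym_psd_def)
  have psdA: "0 \<le> x \<bullet> (A *v x)" for x
    using sym_pd_imp_sym_psd[OF A] by (simp add: sym_psd_def)
  obtain SA where SA: "sym_psd SA" "SA ** SA = A"
    using sym_psd_imp_square[OF sym_pd_imp_sym_psd[OF A]] .
  obtain SB where SB: "sym_psd SB" "SB ** SB = B"
    using sym_psd_imp_square[OF B] .
  have square_form: "(norm (S *v x))\<^sup>2 = x \<bullet> ((S ** S) *v x)" if "sym_psd S" for S :: "real^'m^'m" and x
    using that
    by (simp add: sym_psd_def power2_norm_eq_inner symmetric_matrix_inner[symmetric]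
        matrix_vector_mul_assoc)

  define e where "e t = z' t \<bullet> z' t + z t \<bullet> (A *v z t)" for t
  define e' where "e' t = - 2 * (z' t \<bullet> (B *v z' t))" for t
  define e'' where "e'' t = - 2 * (z' t \<bullet> (B *v z2 t) + z2 t \<bullet> (B *v z' t))" for t
  have de: "(e has_vector_derivative e' t) (at t within {0..})" if "0 \<le> t" for t
  proof -
    have "(e has_vector_derivative (z' t \<bullet> z2 t + z2 t \<bullet> z' t)
        + (z t \<bullet> (A *v z' t) + z' t \<bullet> (A *v z t))) (at t within {0..})"
      unfolding e_def[abs_def]
      by (intro has_vector_derivative_add bounded_bilinear.has_vector_derivative[OF bounded_bilinear_inner]
          has_vector_derivative_matrix_vector_mult dz d1 that)
    moreover have "(z' t \<bullet> z2 t + z2 t \<bullet> z' t) + (z t \<bullet> (A *v z' t) + z' t \<bullet> (A *v z t)) = e' t"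
      using symmetric_matrix_inner[OF symA, of "z t" "z' t"]
      by (simp add: e'_def z2_def inner_diff_right inner_diff_left inner_commute)
    ultimately show ?thesis by simp
  qed
  have de': "(e' has_vector_derivative e'' t) (at t within {0..})" if "0 \<le> t" for t
    unfolding e'_def[abs_def] e''_def
    by (intro has_vector_derivative_mult_right bounded_bilinear.has_vector_derivative[OF bounded_bilinear_inner]
        has_vector_derivative_matrix_vector_mult d1 that)
  have anti: "e t \<le> e s" if "0 \<le> s" "s \<le> t" for s t
  proof (rule DERIV_nonpos_imp_decreasing_open[OF that(2)])
    have "continuous_on {0..} e"
      by (rule continuous_on_vector_derivative) (use de in auto)
    then show "continuous_on {s..t} e" by (rule continuous_on_subset) (use that in auto)
    fix x assume "s < x" "x < t"
    then have "at x within {0..} = at x"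
      using that by (intro at_within_interior) auto
    then have "(e has_real_derivative e' x) (at x)"
      using de[of x] \<open>s < x\<close> that by (simp add: has_real_derivative_iff_has_vector_derivative)
    then show "\<exists>y. (e has_real_derivative y) (at x) \<and> y \<le> 0"
      using psdB[of "z' x"] by (auto simp: e'_def)
  qed
  have e_nonneg: "0 \<le> e t" for t using psdA by (simp add: e_def)
  have e_lim: "(e \<longlongrightarrow> Inf (e ` {0..})) at_top"
    by (rule nonincreasing_nonneg_tendsto) (use anti e_nonneg in auto)

  have norm_le: "norm x \<le> sqrt (e 0)" if "(norm x)\<^sup>2 \<le> e t" "0 \<le> t" for x :: "real^'m" and t
    using that anti[of 0 t] by (intro real_le_rsqrt) simp
  have b1: "bounded (z' ` {0..})"
    unfolding bounded_iff using psdA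
    by (auto intro!: exI[of _ "sqrt (e 0)"] norm_le simp: e_def power2_norm_eq_inner)
  \<comment> \<open>The energy bounds \<open>z\<close> only through its form; the square root of \<open>A\<close> turns this into a norm.\<close>
  have "bounded ((\<lambda>t. SA *v z t) ` {0..})"
    unfolding bounded_iff
    by (auto intro!: exI[of _ "sqrt (e 0)"] norm_le simp: e_def square_form SA)
  from bounded_matrix_vector_mult[OF this, of SA] have bA: "bounded ((\<lambda>t. A *v z t) ` {0..})"
    by (simp add: matrix_vector_mul_assoc SA)
  have b2: "bounded (z2 ` {0..})"
    unfolding z2_def[abs_def]
    by (intro bounded_minus_comp bounded_uminus_comp bA bounded_matrix_vector_mult b1)
  have b3: "bounded (z3 ` {0..})"
    unfolding z3_def[abs_def]
    by (intro bounded_minus_comp bounded_uminus_comp bounded_matrix_vector_mult b1 b2)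
  have b4: "bounded (z4 ` {0..})"
    unfolding z4_def[abs_def]
    by (intro bounded_minus_comp bounded_uminus_comp bounded_matrix_vector_mult b2 b3)
  have bounded_form: "bounded ((\<lambda>t. f t \<bullet> g t) ` {0..})"
    if fg: "bounded (f ` {0..})" "bounded (g ` {0..})" for f g :: "real \<Rightarrow> real^'m"
  proof -
    obtain a b where ab: "\<And>t. 0 \<le> t \<Longrightarrow> norm (f t) \<le> a" "\<And>t. 0 \<le> t \<Longrightarrow> norm (g t) \<le> b"
      using fg unfolding bounded_iff by auto
    have "norm (f t \<bullet> g t) \<le> a * b" if "0 \<le> t" for t
    proof -
      have "norm (f t \<bullet> g t) \<le> norm (f t) * norm (g t)"
        by (simp add: Cauchy_Schwarz_ineq2)
      also have "\<dots> \<le> a * b"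
        using ab(1)[OF that] ab(2)[OF that] order_trans[OF norm_ge_zero ab(1)[OF that]]
        by (intro mult_mono) auto
      finally show ?thesis .
    qed
    then show ?thesis unfolding bounded_iff by auto
  qed
  have "bounded ((\<lambda>t. z' t \<bullet> (B *v z2 t) + z2 t \<bullet> (B *v z' t)) ` {0..})"
    by (intro bounded_plus_comp bounded_form bounded_matrix_vector_mult b1 b2)
  from bounded_scaleR_comp[OF this, of "- 2"] have be'': "bounded (e'' ` {0..})"
    by (simp only: e''_def[abs_def] real_scaleR_def)
  have "(e' \<longlongrightarrow> 0) at_top"
    by (rule derivative_tendsto_0[OF _ _ be'' e_lim]) (simp_all add: de de')
  then have "((\<lambda>t. - e' t / 2) \<longlongrightarrow> - 0 / 2) at_top" by (intro tendsto_intros) auto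
  then have "((\<lambda>t. sqrt ((norm (SB *v z' t))\<^sup>2)) \<longlongrightarrow> sqrt 0) at_top"
    by (intro tendsto_real_sqrt) (simp add: square_form SB e'_def)
  then have "((\<lambda>t. SB *v z' t) \<longlongrightarrow> 0) at_top"
    by (simp add: tendsto_norm_zero_iff)
  from tendsto_matrix_vector_mult[OF this, of SB] have Bz': "((\<lambda>t. B *v z' t) \<longlongrightarrow> 0) at_top"
    by (simp add: matrix_vector_mul_assoc SB)

  have diff1: "((\<lambda>t. C *v z2 t) \<longlongrightarrow> 0) at_top" if "((\<lambda>t. C *v z' t) \<longlongrightarrow> 0) at_top" for C :: "real^'m^'m"
    by (rule derivative_tendsto_0[where f = "\<lambda>t. C *v z' t"])
      (use that in \<open>auto intro!: has_vector_derivative_matrix_vector_mult d1 d2 bounded_matrix_vector_mult b3\<close>)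
  have diff2: "((\<lambda>t. C *v z3 t) \<longlongrightarrow> 0) at_top" if "((\<lambda>t. C *v z' t) \<longlongrightarrow> 0) at_top" for C :: "real^'m^'m"
    by (rule derivative_tendsto_0[where f = "\<lambda>t. C *v z2 t"])
      (use diff1[OF that] in \<open>auto intro!: has_vector_derivative_matrix_vector_mult d2 d3 bounded_matrix_vector_mult b4\<close>)
  have mult_A: "((\<lambda>t. (C ** A) *v z' t) \<longlongrightarrow> 0) at_top" if "((\<lambda>t. C *v z' t) \<longlongrightarrow> 0) at_top" for C :: "real^'m^'m"
  proof -
    have "((\<lambda>t. - (C *v z3 t) - C *v (B *v z2 t)) \<longlongrightarrow> - 0 - C *v 0) at_top"
      by (intro tendsto_intros diff2 that tendsto_matrix_vector_mult diff1 Bz')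
    moreover have "- (C *v z3 t) - C *v (B *v z2 t) = (C ** A) *v z' t" for t
      by (simp add: z3_def matrix_vector_mult_diff_distrib matrix_vector_mul_assoc
          linear_neg[OF matrix_vector_mul_linear])
    ultimately show ?thesis by simp
  qed
  define BA where "BA k = ((\<lambda>C. C ** A) ^^ k) B" for k
  have BA: "((\<lambda>t. BA k *v z' t) \<longlongrightarrow> 0) at_top" for k
    by (induction k) (simp_all add: BA_def Bz' mult_A)

  define V where "V = {v \<in> W. \<forall>k. BA k *v v = 0}"
  have V: "subspace V" "\<And>v. v \<in> V \<Longrightarrow> A *v v \<in> V"
  proof -
    show "subspace V"
      using W(1) unfolding V_def subspace_def
      by (auto simp: matrix_vector_right_distrib matrix_vector_mult_scaleR)
    fix v assume v: "v \<in> V"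
    have "BA k *v (A *v v) = BA (Suc k) *v v" for k
      by (simp add: BA_def matrix_vector_mul_assoc)
    then show "A *v v \<in> V" using v W(2) by (simp add: V_def)
  qed
  have V0: "v = 0" if "v \<in> V" for v
  proof (rule ccontr)
    assume "v \<noteq> 0"
    with symmetric_matrix_eigenvector_in_subspace[OF symA V that]
    obtain u \<omega> where u: "u \<in> V" "norm u = 1" "A *v u = \<omega> *\<^sub>R u" by blast
    have "B *v u = 0" using u(1) by (auto simp: V_def BA_def dest: spec[of _ 0])
    then have "u = 0" using u undamped[of u \<omega>] by (auto simp: V_def)
    then show False using u by simp
  qed

  have z'_lim: "(z' \<longlongrightarrow> 0) at_top"
  proof (rule ccontr)
    assume "\<not> (z' \<longlongrightarrow> 0) at_top"
    then obtain \<epsilon> where "0 < \<epsilon>" and "\<not> eventually (\<lambda>t. dist (z' t) 0 < \<epsilon>) at_top"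
      unfolding tendsto_iff by blast
    then have "\<exists>t\<ge>real n. \<epsilon> \<le> norm (z' t)" for n
      unfolding eventually_at_top_linorder by (force simp: not_less)
    then obtain \<tau> where \<tau>: "\<And>n. real n \<le> \<tau> n" "\<And>n. \<epsilon> \<le> norm (z' (\<tau> n))" by metis
    have \<tau>0: "0 \<le> \<tau> n" for n using \<tau>(1)[of n] by (meson of_nat_0_le_iff order_trans)
    have \<tau>_lim: "filterlim \<tau> at_top sequentially"
      using filterlim_real_sequentially by (rule filterlim_at_top_mono) (simp add: \<tau>)
    have "bounded (range (\<lambda>n. z' (\<tau> n)))"
      by (rule bounded_subset[OF b1]) (use \<tau>0 in auto)
    then obtain l r where r: "strict_mono (r :: nat \<Rightarrow> nat)" and l: "((\<lambda>n. z' (\<tau> n)) \<circ> r) \<longlonglongrightarrow> l"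
      using bounded_imp_convergent_subsequence by blast
    have "l \<in> W"
      using closed_sequentially[OF closed_subspace[OF W(1)] _ l] z'W \<tau>0 by simp
    moreover have "BA k *v l = 0" for k
    proof (rule LIMSEQ_unique)
      show "(\<lambda>n. BA k *v (((\<lambda>n. z' (\<tau> n)) \<circ> r) n)) \<longlonglongrightarrow> BA k *v l"
        by (rule tendsto_matrix_vector_mult[OF l])
      have "(\<lambda>n. BA k *v z' (\<tau> n)) \<longlonglongrightarrow> 0"
        by (rule filterlim_compose[OF BA \<tau>_lim])
      then show "(\<lambda>n. BA k *v (((\<lambda>n. z' (\<tau> n)) \<circ> r) n)) \<longlonglongrightarrow> 0"
        using LIMSEQ_subseq_LIMSEQ[OF _ r, of "\<lambda>n. BA k *v z' (\<tau> n)" 0] by (simp add: o_def)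
    qed
    ultimately have "l \<in> V" by (simp add: V_def)
    then have "l = 0" by (rule V0)
    moreover have "\<epsilon> \<le> norm l"
      by (rule LIMSEQ_le_const[OF tendsto_norm[OF l]]) (simp add: \<tau>(2))
    ultimately show False using \<open>0 < \<epsilon>\<close> by simp
  qed
  \<comment> \<open>The equation now gives \<open>A z = - z'' - B z' \<rightarrow> 0\<close>, and \<open>A\<close> is invertible.\<close>
  have "(z2 \<longlongrightarrow> 0) at_top" using diff1[of "mat 1"] z'_lim by simp
  from tendsto_diff[OF tendsto_minus[OF this] Bz']
  have Az: "((\<lambda>t. A *v z t) \<longlongrightarrow> 0) at_top" by (simp add: z2_def)
  obtain Ai where Ai: "Ai ** A = mat 1"
    using sym_pd_kernel[OF A] matrix_left_invertible_ker[of A] by blast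
  from tendsto_matrix_vector_mult[OF Az, of Ai] show ?thesis
    by (simp add: matrix_vector_mul_assoc Ai)
qed

section \<open>Block vectors and Laplacians\<close>

definition blk :: "'a^('q::finite \<times> 'n::finite) \<Rightarrow> 'q \<Rightarrow> 'a^'n" where
  "blk v i = (\<chi> k. v $ (i, k))"

definition stack :: "('q::finite \<Rightarrow> 'a^'n::finite) \<Rightarrow> 'a^('q \<times> 'n)" where
  "stack f = (\<chi> a. f (fst a) $ snd a)"

lemma blk_stack [simp]: "blk (stack f) i = f i"
  by (simp add: blk_def stack_def)

lemma vec_eq_blkI: "(\<And>i. blk v i = blk w i) \<Longrightarrow> v = w"
  by (simp add: blk_def vec_eq_iff)

lemma blk_linear [simp]:
  fixes v w :: "real^('q::finite \<times> 'n::finite)"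
  shows "blk (v + w) i = blk v i + blk w i" "blk (v - w) i = blk v i - blk w i"
    "blk (- v) i = - blk v i" "blk (c *\<^sub>R v) i = c *\<^sub>R blk v i" "blk (0 :: real^('q \<times> 'n)) i = 0"
  by (simp_all add: blk_def vec_eq_iff)

lemma vec_eq_0_iff_blk: "v = 0 \<longleftrightarrow> (\<forall>i. blk v i = 0)" for v :: "real^('q::finite \<times> 'n::finite)"
  using vec_eq_blkI[of v 0] by auto

lemma sum_UNIV_prod:
  fixes f :: "'q::finite \<times> 'n::finite \<Rightarrow> 'a::comm_monoid_add"
  shows "(\<Sum>b\<in>UNIV. f b) = (\<Sum>j\<in>UNIV. \<Sum>l\<in>UNIV. f (j, l))"
  by (simp add: sum.cartesian_product flip: UNIV_Times_UNIV)

lemma inner_blk: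
  fixes v w :: "real^('q::finite \<times> 'n::finite)"
  shows "v \<bullet> w = (\<Sum>i\<in>UNIV. blk v i \<bullet> blk w i)"
  by (simp add: inner_vec_def sum_UNIV_prod blk_def)

lemma blk_matrix_vector_mult:
  fixes A :: "real^('q::finite \<times> 'n::finite)^('q \<times> 'n)"
  assumes "\<And>i j. (\<chi> k l. A $ (i, k) $ (j, l)) = G i j"
  shows "blk (A *v v) i = (\<Sum>j\<in>UNIV. G i j *v blk v j)"
  by (simp add: vec_eq_iff blk_def matrix_vector_mult_def sum_UNIV_prod flip: assms)

lemma sum_matrix_vector_mult:
  fixes G :: "'j \<Rightarrow> real^'n^'m"
  shows "(\<Sum>j\<in>J. G j) *v x = (\<Sum>j\<in>J. G j *v x)"
  by (induction J rule: infinite_finite_induct) (simp_all add: matrix_vector_mult_add_rdistrib)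

lemma matrix_vector_mult_sum:
  fixes G :: "real^'n^'m"
  shows "G *v (\<Sum>j\<in>J. f j) = (\<Sum>j\<in>J. G *v f j)"
  by (induction J rule: infinite_finite_induct) (simp_all add: matrix_vector_right_distrib)

lemma blk_kronecker_mat_1:
  fixes P :: "real^'n^'n" and v :: "real^('q::finite \<times> 'n::finite)"
  shows "blk (kronecker (mat 1 :: real^'q^'q) P *v v) i = P *v blk v i"
proof -
  have "blk (kronecker (mat 1 :: real^'q^'q) P *v v) i
      = (\<Sum>j\<in>UNIV. (if i = j then P else 0) *v blk v j)"
    by (rule blk_matrix_vector_mult) (auto simp: kronecker_def mat_def vec_eq_iff)
  also have "\<dots> = (\<Sum>j\<in>UNIV. if i = j then P *v blk v j else 0)"
    by (intro sum.cong) auto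
  finally show ?thesis by simp
qed

lemma blk_lap:
  fixes W :: "'q::finite \<Rightarrow> 'q \<Rightarrow> real^'n^'n"
  assumes "\<And>i. W i i = 0"
  shows "blk (lap W *v v) i = (\<Sum>j\<in>UNIV. W i j *v (blk v i - blk v j))"
proof -
  have "blk (lap W *v v) i
      = (\<Sum>j\<in>UNIV. (if i = j then \<Sum>k\<in>UNIV. W i k else - W i j) *v blk v j)"
    by (rule blk_matrix_vector_mult) (auto simp: lap_def vec_eq_iff)
  also have "\<dots> = (\<Sum>j\<in>UNIV. (if i = j then (\<Sum>k\<in>UNIV. W i k) *v blk v i else 0) - W i j *v blk v j)"
    using assms by (intro sum.cong) (auto simp: matrix_vector_mult_def vec_eq_iff sum_negf)
  also have "\<dots> = (\<Sum>j\<in>UNIV. W i j *v (blk v i - blk v j))"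
    by (simp add: sum_subtractf sum_matrix_vector_mult matrix_vector_mult_diff_distrib)
  finally show ?thesis .
qed

text \<open>Exchanging the two nodes of an edge and averaging gives the familiar edge-wise form.\<close>

lemma lap_form:
  fixes W :: "'q::finite \<Rightarrow> 'q \<Rightarrow> real^'n^'n"
  assumes diag: "\<And>i. W i i = 0" and comm: "\<And>i j. W i j = W j i"
  shows "v \<bullet> (lap W *v w)
    = (\<Sum>i\<in>UNIV. \<Sum>j\<in>UNIV. (blk v i - blk v j) \<bullet> (W i j *v (blk w i - blk w j))) / 2"
proof -
  define f where "f i j = blk v i \<bullet> (W i j *v (blk w i - blk w j))" for i j
  have X: "v \<bullet> (lap W *v w) = (\<Sum>i\<in>UNIV. \<Sum>j\<in>UNIV. f i j)"
    by (simp add: inner_blk blk_lap diag inner_sum_right f_def)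
  have "(\<Sum>i\<in>UNIV. \<Sum>j\<in>UNIV. (blk v i - blk v j) \<bullet> (W i j *v (blk w i - blk w j)))
      = (\<Sum>i\<in>UNIV. \<Sum>j\<in>UNIV. f i j + f j i)"
  proof (intro sum.cong refl)
    fix i j
    have "W j i *v (blk w j - blk w i) = - (W i j *v (blk w i - blk w j))"
      by (simp add: comm[of j i] matrix_vector_mult_diff_distrib)
    then show "(blk v i - blk v j) \<bullet> (W i j *v (blk w i - blk w j)) = f i j + f j i"
      by (simp add: f_def inner_diff_left)
  qed
  also have "\<dots> = (\<Sum>i\<in>UNIV. \<Sum>j\<in>UNIV. f i j) + (\<Sum>i\<in>UNIV. \<Sum>j\<in>UNIV. f j i)"
    by (simp add: sum.distrib)
  also have "(\<Sum>i\<in>UNIV. \<Sum>j\<in>UNIV. f j i) = (\<Sum>i\<in>UNIV. \<Sum>j\<in>UNIV. f i j)"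
    by (rule sum.swap)
  finally show ?thesis by (simp add: X)
qed

lemma sym_psd_lap:
  fixes W :: "'q::finite \<Rightarrow> 'q \<Rightarrow> real^'n^'n"
  assumes diag: "\<And>i. W i i = 0" and comm: "\<And>i j. W i j = W j i" and psd: "\<And>i j. sym_psd (W i j)"
  shows "sym_psd (lap W)"
  unfolding sym_psd_def
proof
  have W: "x \<bullet> (W i j *v y) = y \<bullet> (W i j *v x)" for x y i j
    using psd[of i j] symmetric_matrix_inner[of "W i j" x y]
    by (simp add: sym_psd_def inner_commute)
  have "x \<bullet> (lap W *v y) = y \<bullet> (lap W *v x)" for x y
    unfolding lap_form[OF diag comm] by (subst W) simp
  then show "transpose (lap W) = lap W"
    by (intro symmetric_matrixI) (simp add: inner_commute)
  show "\<forall>x. 0 \<le> x \<bullet> (lap W *v x)"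
    using psd unfolding lap_form[OF diag comm] by (auto simp: sym_psd_def intro!: sum_nonneg divide_nonneg_pos)
qed

text \<open>The forces along an edge cancel, as they are opposite at its two ends.\<close>

lemma sum_blk_lap:
  fixes W :: "'q::finite \<Rightarrow> 'q \<Rightarrow> real^'n^'n"
  assumes diag: "\<And>i. W i i = 0" and comm: "\<And>i j. W i j = W j i"
  shows "(\<Sum>i\<in>UNIV. blk (lap W *v v) i) = 0"
proof -
  let ?f = "\<lambda>i j. W i j *v blk v i"
  have "(\<Sum>i\<in>UNIV. blk (lap W *v v) i) = (\<Sum>i\<in>UNIV. \<Sum>j\<in>UNIV. ?f i j) - (\<Sum>i\<in>UNIV. \<Sum>j\<in>UNIV. W i j *v blk v j)"
    by (simp add: blk_lap diag matrix_vector_mult_diff_distrib sum_subtractf)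
  also have "(\<Sum>i\<in>UNIV. \<Sum>j\<in>UNIV. W i j *v blk v j) = (\<Sum>i\<in>UNIV. \<Sum>j\<in>UNIV. ?f j i)"
    by (intro sum.cong refl) (metis comm)
  also have "\<dots> = (\<Sum>i\<in>UNIV. \<Sum>j\<in>UNIV. ?f i j)" by (rule sum.swap)
  finally show ?thesis by simp
qed

section \<open>The averaging projection\<close>

definition avg :: "real^('q::finite \<times> 'n::finite)^('q \<times> 'n)" where
  "avg = (\<chi> a b. if snd a = snd b then 1 / real CARD('q) else 0)"

lemma blk_avg:
  fixes v :: "real^('q::finite \<times> 'n::finite)"
  shows "blk (avg *v v) i = (1 / real CARD('q)) *\<^sub>R (\<Sum>j\<in>UNIV. blk v j)"
proof -
  have "blk (avg *v v) i = (\<Sum>j\<in>(UNIV::'q set). ((1 / real CARD('q)) *\<^sub>R mat 1) *v blk v j)"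
    by (rule blk_matrix_vector_mult) (auto simp: avg_def mat_def vec_eq_iff)
  then show ?thesis by (simp add: scaleR_matrix_vector_assoc[symmetric] scaleR_sum_right)
qed

lemma avg_idempotent:
  fixes v :: "real^('q::finite \<times> 'n::finite)"
  shows "avg *v (avg *v v) = avg *v v"
  by (intro vec_eq_blkI) (simp add: blk_avg sum_constant_scaleR del: sum_constant)

lemma lap_avg:
  fixes W :: "'q::finite \<Rightarrow> 'q \<Rightarrow> real^'n^'n"
  assumes "\<And>i. W i i = 0"
  shows "lap W *v (avg *v v) = 0"
  by (intro vec_eq_blkI) (simp add: blk_lap assms blk_avg)

lemma avg_lap:
  fixes W :: "'q::finite \<Rightarrow> 'q \<Rightarrow> real^'n^'n"
  assumes "\<And>i. W i i = 0" "\<And>i j. W i j = W j i"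
  shows "avg *v (lap W *v v) = 0"
  by (intro vec_eq_blkI) (simp only: blk_avg sum_blk_lap[OF assms] blk_linear scaleR_zero_right)

text \<open>
  New coordinates adapted to the average: the component of node \<open>i\<^sub>0\<close> is replaced by the average, that
  of any other node by its difference from node \<open>i\<^sub>0\<close>.
\<close>

definition avg_coords :: "'q \<Rightarrow> real^('q::finite \<times> 'n::finite)^('q \<times> 'n)" where
  "avg_coords i\<^sub>0 = (\<chi> a b. if snd a = snd b
      then (if fst a = i\<^sub>0 then 1 / real CARD('q)
            else (if fst b = fst a then 1 else 0) - (if fst b = i\<^sub>0 then 1 else 0))
      else 0)"

lemma blk_avg_coords:
  fixes v :: "real^('q::finite \<times> 'n::finite)"
  shows "blk (avg_coords i\<^sub>0 *v v) i = (if i = i\<^sub>0 then blk (avg *v v) i else blk v i - blk v i\<^sub>0)"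
proof -
  define c where "c j = (if i = i\<^sub>0 then 1 / real CARD('q)
      else (if j = i then 1 else 0) - (if j = i\<^sub>0 then 1 else 0))" for j
  have "blk (avg_coords i\<^sub>0 *v v) i = (\<Sum>j\<in>UNIV. (\<chi> k l. avg_coords i\<^sub>0 $ (i, k) $ (j, l)) *v blk v j)"
    by (rule blk_matrix_vector_mult) simp
  also have "\<dots> = (\<Sum>j\<in>UNIV. c j *\<^sub>R blk v j)"
  proof (intro sum.cong refl)
    fix j
    have "(\<chi> k l. avg_coords i\<^sub>0 $ (i, k) $ (j, l)) = (c j *\<^sub>R mat 1 :: real^'n^'n)"
      by (auto simp: avg_coords_def c_def mat_def vec_eq_iff)
    then show "(\<chi> k l. avg_coords i\<^sub>0 $ (i, k) $ (j, l)) *v blk v j = c j *\<^sub>R blk v j"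
      by (simp add: scaleR_matrix_vector_assoc[symmetric])
  qed
  also have "\<dots> = (if i = i\<^sub>0 then blk (avg *v v) i else blk v i - blk v i\<^sub>0)"
  proof (cases "i = i\<^sub>0")
    case False
    then have "c j *\<^sub>R blk v j = (if j = i then blk v j else 0) - (if j = i\<^sub>0 then blk v j else 0)" for j
      by (simp add: c_def)
    with False show ?thesis by (simp add: sum_subtractf)
  qed (simp add: c_def blk_avg scaleR_sum_right)
  finally show ?thesis .
qed

lemma avg_coords_left_invertible:
  obtains Ti where "Ti ** (avg_coords i\<^sub>0 :: real^('q::finite \<times> 'n::finite)^('q \<times> 'n)) = mat 1"
proof -
  have ker: "v = 0" if "avg_coords i\<^sub>0 *v v = 0" for v :: "real^('q \<times> 'n)"
  proof (rule vec_eq_blkI)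
    fix i
    have eq: "blk v j = blk v i\<^sub>0" for j
      using arg_cong[OF that, of "\<lambda>w. blk w j"] by (cases "j = i\<^sub>0") (simp_all add: blk_avg_coords)
    have "blk (avg *v v) i\<^sub>0 = 0"
      using arg_cong[OF that, of "\<lambda>w. blk w i\<^sub>0"] by (simp add: blk_avg_coords)
    moreover have "blk (avg *v v) i\<^sub>0 = blk v i\<^sub>0"
    proof -
      have "(\<Sum>j\<in>UNIV. blk v j) = (\<Sum>j\<in>(UNIV::'q set). blk v i\<^sub>0)"
        by (intro sum.cong refl eq)
      then show ?thesis unfolding blk_avg by (simp add: sum_constant_scaleR del: sum_constant)
    qed
    ultimately show "blk v i = blk 0 i" using eq[of i] by simp
  qed
  have "\<exists>Ti. Ti ** (avg_coords i\<^sub>0 :: real^('q \<times> 'n)^('q \<times> 'n)) = mat 1"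
    by (intro matrix_left_invertible_ker[THEN iffD2] allI impI) (rule ker)
  then show thesis by (elim exE) (rule that)
qed

text \<open>In the new coordinates, averaging keeps the block of \<open>i\<^sub>0\<close> and deletes all others.\<close>

lemma avg_coords_avg:
  "(avg_coords i\<^sub>0 ** avg :: real^('q::finite \<times> 'n::finite)^('q \<times> 'n))
    = (\<chi> a b. if a \<in> {i\<^sub>0} \<times> UNIV then avg_coords i\<^sub>0 $ a $ b else 0)" (is "_ = ?N")
proof -
  have "(avg_coords i\<^sub>0 ** avg) *v v = ?N *v v" for v :: "real^('q \<times> 'n)"
  proof (rule vec_eq_blkI)
    fix i
    have "(?N *v v) $ a = (if fst a = i\<^sub>0 then (avg_coords i\<^sub>0 *v v) $ a else 0)" for a
      by (cases "fst a = i\<^sub>0") (simp_all add: matrix_vector_mult_def mem_Times_iff)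
    then have "blk (?N *v v) i = (if i = i\<^sub>0 then blk (avg_coords i\<^sub>0 *v v) i else 0)"
      unfolding blk_def by (simp add: vec_eq_iff)
    moreover have "blk (avg_coords i\<^sub>0 *v (avg *v v)) i
        = (if i = i\<^sub>0 then blk (avg_coords i\<^sub>0 *v v) i else 0)"
      unfolding blk_avg_coords avg_idempotent by (simp add: blk_avg)
    ultimately show "blk ((avg_coords i\<^sub>0 ** avg) *v v) i = blk (?N *v v) i"
      by (simp only: matrix_vector_mul_assoc)
  qed
  then show ?thesis unfolding matrix_eq by blast
qed

section \<open>Complex eigenvectors in terms of real vectors\<close>

definition Re_vec :: "complex^'n \<Rightarrow> real^'n" where "Re_vec v = (\<chi> a. Re (v $ a))"
definition Im_vec :: "complex^'n \<Rightarrow> real^'n" where "Im_vec v = (\<chi> a. Im (v $ a))"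

lemma complex_vec_eq_iff: "v = w \<longleftrightarrow> Re_vec v = Re_vec w \<and> Im_vec v = Im_vec w"
  by (auto simp: vec_eq_iff Re_vec_def Im_vec_def complex_eq_iff)

lemma Re_Im_vec_0 [simp]: "Re_vec 0 = 0" "Im_vec 0 = 0"
  by (simp_all add: vec_eq_iff Re_vec_def Im_vec_def)

lemma Re_Im_vec_mult_of_real:
  "Re_vec (map_matrix complex_of_real A *v v) = A *v Re_vec v"
  "Im_vec (map_matrix complex_of_real A *v v) = A *v Im_vec v"
  by (simp_all add: vec_eq_iff Re_vec_def Im_vec_def matrix_vector_mult_def)

lemma Re_Im_vec_mult_i:
  "Re_vec (map_matrix (\<lambda>r. \<i> * complex_of_real r) A *v v) = - (A *v Im_vec v)"
  "Im_vec (map_matrix (\<lambda>r. \<i> * complex_of_real r) A *v v) = A *v Re_vec v"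
  by (simp_all add: vec_eq_iff Re_vec_def Im_vec_def matrix_vector_mult_def sum_negf)

lemma Re_Im_vec_add:
  "Re_vec (v + w) = Re_vec v + Re_vec w" "Im_vec (v + w) = Im_vec v + Im_vec w"
  by (simp_all add: vec_eq_iff Re_vec_def Im_vec_def)

lemma Re_Im_vec_scale:
  "Re_vec (z *s v) = Re z *\<^sub>R Re_vec v - Im z *\<^sub>R Im_vec v"
  "Im_vec (z *s v) = Re z *\<^sub>R Im_vec v + Im z *\<^sub>R Re_vec v"
  by (simp_all add: vec_eq_iff Re_vec_def Im_vec_def)

lemma map_matrix_of_real_mult:
  "map_matrix complex_of_real (A ** B) = map_matrix complex_of_real A ** map_matrix complex_of_real B"
  by (simp add: vec_eq_iff matrix_matrix_mult_def)

lemma map_matrix_i_mult: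
  "map_matrix complex_of_real E ** map_matrix (\<lambda>r. \<i> * complex_of_real r) A
    = map_matrix (\<lambda>r. \<i> * complex_of_real r) (E ** A)"
  "map_matrix (\<lambda>r. \<i> * complex_of_real r) A ** map_matrix complex_of_real E
    = map_matrix (\<lambda>r. \<i> * complex_of_real r) (A ** E)"
  by (simp_all add: vec_eq_iff matrix_matrix_mult_def sum_distrib_left mult_ac)

lemma eigen_equation_real_imag:
  "(map_matrix complex_of_real B + map_matrix (\<lambda>r. \<i> * complex_of_real r) A) *v v = z *s v \<longleftrightarrow>
    B *v Re_vec v - A *v Im_vec v = Re z *\<^sub>R Re_vec v - Im z *\<^sub>R Im_vec v \<and>
    B *v Im_vec v + A *v Re_vec v = Re z *\<^sub>R Im_vec v + Im z *\<^sub>R Re_vec v"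
  unfolding matrix_vector_mult_add_rdistrib complex_vec_eq_iff[of "_ + _"] Re_Im_vec_add
    Re_Im_vec_mult_of_real Re_Im_vec_mult_i Re_Im_vec_scale
  by simp

text \<open>The form of the symmetric matrix \<open>A\<close> is real on complex vectors, so \<open>\<i> A\<close> only adds to \<open>Im z\<close>.\<close>

lemma Re_eigenvalue_form:
  assumes sym: "transpose A = A"
    and eig: "(map_matrix complex_of_real B + map_matrix (\<lambda>r. \<i> * complex_of_real r) A) *v v = z *s v"
  shows "Re z * (Re_vec v \<bullet> Re_vec v + Im_vec v \<bullet> Im_vec v)
    = Re_vec v \<bullet> (B *v Re_vec v) + Im_vec v \<bullet> (B *v Im_vec v)"
proof -
  let ?a = "Re_vec v" and ?b = "Im_vec v"
  have e: "B *v ?a - A *v ?b = Re z *\<^sub>R ?a - Im z *\<^sub>R ?b"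
    "B *v ?b + A *v ?a = Re z *\<^sub>R ?b + Im z *\<^sub>R ?a"
    using eig unfolding eigen_equation_real_imag by auto
  have "?a \<bullet> (B *v ?a - A *v ?b) + ?b \<bullet> (B *v ?b + A *v ?a) = Re z * (?a \<bullet> ?a + ?b \<bullet> ?b)"
    unfolding e by (simp add: inner_diff_right inner_add_right inner_commute distrib_left)
  moreover have "?a \<bullet> (A *v ?b) = ?b \<bullet> (A *v ?a)"
    using symmetric_matrix_inner[OF sym] by (simp add: inner_commute)
  ultimately show ?thesis by (simp add: inner_diff_right inner_add_right)
qed

section \<open>Synchronous modes of a normalised network\<close>

text \<open>
  The network in the coordinates \<open>M\<^sup>1\<^sup>/\<^sup>2 x\<close>, in which the mass matrix is the identity and the equation of
  motion reads \<open>y'' + A y + B y' = 0\<close>.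
\<close>

locale scaled_network =
  fixes P :: "real^'n^'n" and C S :: "'q::finite \<Rightarrow> 'q \<Rightarrow> real^'n^'n"
  assumes P: "sym_pd P"
    and C: "\<And>i. C i i = 0" "\<And>i j. C i j = C j i" "\<And>i j. sym_psd (C i j)"
    and S: "\<And>i. S i i = 0" "\<And>i j. S i j = S j i" "\<And>i j. sym_psd (S i j)"
begin

abbreviation A :: "real^('q \<times> 'n)^('q \<times> 'n)" where
  "A \<equiv> kronecker (mat 1 :: real^'q^'q) P + lap S"

abbreviation B :: "real^('q \<times> 'n)^('q \<times> 'n)" where
  "B \<equiv> lap C"

abbreviation \<Gamma> :: "complex^('q \<times> 'n)^('q \<times> 'n)" where
  "\<Gamma> \<equiv> map_matrix complex_of_real B + map_matrix (\<lambda>r. \<i> * complex_of_real r) A"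

text \<open>
  An undamped mode is an eigenvector of \<open>A\<close> on which \<open>B\<close> vanishes. Since the average commutes with \<open>A\<close>
  and is annihilated by \<open>B\<close>, subtracting its average from an undamped mode leaves zero or an undamped
  mode. All undamped modes are therefore synchronous iff none of them has average zero.
\<close>

definition only_synchronous_modes :: bool where
  "only_synchronous_modes \<longleftrightarrow>
     (\<forall>v \<omega>. avg *v v = 0 \<longrightarrow> A *v v = \<omega> *\<^sub>R v \<longrightarrow> B *v v = 0 \<longrightarrow> v = 0)"

lemma blk_A: "blk (A *v v) i = P *v blk v i + blk (lap S *v v) i"
  by (simp add: matrix_vector_mult_add_rdistrib blk_kronecker_mat_1)

lemma sym_psd_B: "sym_psd B"
  by (rule sym_psd_lap) (fact C)+

lemma sym_pd_A: "sym_pd A"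
  unfolding sym_pd_def
proof (intro conjI allI impI)
  have form: "x \<bullet> (A *v y) = (\<Sum>i\<in>UNIV. blk x i \<bullet> (P *v blk y i)) + x \<bullet> (lap S *v y)" for x y
    by (simp add: inner_blk blk_A inner_add_right sum.distrib)
  have psd: "sym_psd (lap S)" by (rule sym_psd_lap) (fact S)+
  have symP: "x \<bullet> (P *v y) = (P *v x) \<bullet> y" for x y
    using P by (intro symmetric_matrix_inner) (simp add: sym_pd_def)
  have symS: "x \<bullet> (lap S *v y) = (lap S *v x) \<bullet> y" for x y
    using psd by (intro symmetric_matrix_inner) (simp add: sym_psd_def)
  show "transpose A = A"
  proof (rule symmetric_matrixI)
    fix x y
    have "x \<bullet> (A *v y) = y \<bullet> (A *v x)"
      unfolding form by (simp add: symP[of "blk x _"] symS[of x] inner_commute)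
    then show "x \<bullet> (A *v y) = (A *v x) \<bullet> y" by (simp only: inner_commute)
  qed
  fix x :: "real^('q \<times> 'n)" assume "x \<noteq> 0"
  then obtain i where i: "blk x i \<noteq> 0" using vec_eq_blkI[of x 0] by auto
  have pos: "0 < u \<bullet> (P *v u)" if "u \<noteq> 0" for u
    using P that by (simp add: sym_pd_def)
  have "0 < (\<Sum>i\<in>UNIV. blk x i \<bullet> (P *v blk x i))"
  proof (rule sum_pos2[of _ i])
    show "0 \<le> blk x j \<bullet> (P *v blk x j)" for j
      using pos[of "blk x j"] by (cases "blk x j = 0") auto
  qed (use pos[OF i] in auto)
  moreover have "0 \<le> x \<bullet> (lap S *v x)" using psd by (simp add: sym_psd_def)
  ultimately show "0 < x \<bullet> (A *v x)" unfolding form by linarith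
qed

lemma avg_A: "avg *v (A *v v) = A *v (avg *v v)"
proof (rule vec_eq_blkI)
  fix i
  have "blk (avg *v (A *v v)) i = P *v blk (avg *v v) i"
    by (simp add: blk_avg blk_A sum.distrib sum_blk_lap[OF S(1,2)] matrix_vector_mult_scaleR
        matrix_vector_mult_sum)
  then show "blk (avg *v (A *v v)) i = blk (A *v (avg *v v)) i"
    by (simp add: blk_A lap_avg S(1))
qed

lemma avg_B: "avg *v (B *v v) = 0" "B *v (avg *v v) = 0"
  by (rule avg_lap lap_avg; fact C)+

text \<open>The deviation \<open>z = y - avg y\<close> solves the same equation inside the kernel of the average.\<close>

lemma deviation_tendsto_0:
  assumes modes: only_synchronous_modes
    and dy: "\<And>t. 0 \<le> t \<Longrightarrow> (y has_vector_derivative y' t) (at t within {0..})"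
    and dy': "\<And>t. 0 \<le> t \<Longrightarrow>
      (y' has_vector_derivative - (A *v y t) - B *v y' t) (at t within {0..})"
  shows "((\<lambda>t. y t - avg *v y t) \<longlongrightarrow> 0) at_top"
proof (rule damped_oscillator_tendsto_0[OF sym_pd_A sym_psd_B])
  show "subspace {v :: real^('q \<times> 'n). avg *v v = 0}"
    by (auto simp: subspace_def matrix_vector_right_distrib matrix_vector_mult_scaleR)
  show "A *v w \<in> {v. avg *v v = 0}" if "w \<in> {v. avg *v v = 0}" for w
    using that by (simp add: avg_A)
  show "v = 0" if "v \<in> {v. avg *v v = 0}" "A *v v = \<omega> *\<^sub>R v" "B *v v = 0" for v \<omega>
    using modes that unfolding only_synchronous_modes_def by blast
  fix t :: real assume t: "0 \<le> t"
  show "((\<lambda>t. y t - avg *v y t) has_vector_derivative y' t - avg *v y' t) (at t within {0..})"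
    by (intro has_vector_derivative_diff has_vector_derivative_matrix_vector_mult dy t)
  have "((\<lambda>t. y' t - avg *v y' t) has_vector_derivative
      (- (A *v y t) - B *v y' t) - avg *v (- (A *v y t) - B *v y' t)) (at t within {0..})"
    by (intro has_vector_derivative_diff has_vector_derivative_matrix_vector_mult dy' t)
  moreover have "(- (A *v y t) - B *v y' t) - avg *v (- (A *v y t) - B *v y' t)
      = - (A *v (y t - avg *v y t)) - B *v (y' t - avg *v y' t)"
    by (simp only: matrix_vector_mult_diff_distrib linear_neg[OF matrix_vector_mul_linear] avg_A avg_B)
      simp
  ultimately show "((\<lambda>t. y' t - avg *v y' t) has_vector_derivative
      - (A *v (y t - avg *v y t)) - B *v (y' t - avg *v y' t)) (at t within {0..})"
    by simp
  show "y' t - avg *v y' t \<in> {v. avg *v v = 0}"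
    by (simp add: matrix_vector_mult_diff_distrib avg_idempotent)
qed

text \<open>
  \<open>Re z\<close> is the normalised form of the positive semidefinite matrix \<open>B\<close> at \<open>v\<close>, which vanishes only on
  the kernel of \<open>B\<close>.
\<close>

lemma Re_eigenvalue_nonneg:
  assumes "\<Gamma> *v v = z *s v" "v \<noteq> 0"
  shows "0 \<le> Re z"
    and "Re z = 0 \<longleftrightarrow> B *v Re_vec v = 0 \<and> B *v Im_vec v = 0"
proof -
  let ?a = "Re_vec v" and ?b = "Im_vec v"
  have psd: "0 \<le> x \<bullet> (B *v x)" for x using sym_psd_B by (simp add: sym_psd_def)
  have "?a \<noteq> 0 \<or> ?b \<noteq> 0" using \<open>v \<noteq> 0\<close> complex_vec_eq_iff[of v 0] by simp
  then have pos: "0 < ?a \<bullet> ?a + ?b \<bullet> ?b"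
    by (meson add_nonneg_pos add_pos_nonneg inner_ge_zero inner_gt_zero_iff)
  have eq: "Re z * (?a \<bullet> ?a + ?b \<bullet> ?b) = ?a \<bullet> (B *v ?a) + ?b \<bullet> (B *v ?b)"
    using sym_pd_A assms(1) by (intro Re_eigenvalue_form) (simp_all add: sym_pd_def)
  have "0 \<le> Re z * (?a \<bullet> ?a + ?b \<bullet> ?b)"
    unfolding eq by (intro add_nonneg_nonneg psd)
  then show "0 \<le> Re z" using pos by (simp add: zero_le_mult_iff)
  have "Re z = 0 \<longleftrightarrow> ?a \<bullet> (B *v ?a) + ?b \<bullet> (B *v ?b) = 0"
    using pos by (simp flip: eq)
  also have "\<dots> \<longleftrightarrow> ?a \<bullet> (B *v ?a) = 0 \<and> ?b \<bullet> (B *v ?b) = 0"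
    by (rule add_nonneg_eq_0_iff) (rule psd)+
  also have "\<dots> \<longleftrightarrow> B *v ?a = 0 \<and> B *v ?b = 0"
    using sym_psd_form_zero_imp_kernel[OF sym_psd_B] by auto
  finally show "Re z = 0 \<longleftrightarrow> B *v ?a = 0 \<and> B *v ?b = 0" .
qed

text \<open>
  If \<open>Re z = 0\<close>, then \<open>B\<close> drops out of the eigenvalue equation and the real and imaginary parts of the
  eigenvector are undamped modes. Conversely an undamped mode for the eigenvalue \<open>\<omega>\<close> of \<open>A\<close> is an
  eigenvector of \<open>\<Gamma>\<close> for \<open>\<i> \<omega>\<close>.
\<close>

lemma only_synchronous_modes_iff_eigenvalues:
  "only_synchronous_modes \<longleftrightarrow>
     (\<forall>z v. v \<noteq> 0 \<longrightarrow> map_matrix complex_of_real avg *v v = 0 \<longrightarrow> \<Gamma> *v v = z *s v \<longrightarrow> 0 < Re z)"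
    (is "_ \<longleftrightarrow> ?E")
proof
  assume modes: only_synchronous_modes
  show ?E
  proof (intro allI impI)
    fix z v assume v: "v \<noteq> 0" "map_matrix complex_of_real avg *v v = 0" "\<Gamma> *v v = z *s v"
    have "Re z \<noteq> 0"
    proof
      assume "Re z = 0"
      then have B0: "B *v Re_vec v = 0" "B *v Im_vec v = 0"
        using Re_eigenvalue_nonneg(2)[OF v(3,1)] by auto
      have avg0: "avg *v Re_vec v = 0" "avg *v Im_vec v = 0"
        using Re_Im_vec_mult_of_real[of avg v] v(2) by simp_all
      have "A *v Re_vec v = Im z *\<^sub>R Re_vec v" "A *v Im_vec v = Im z *\<^sub>R Im_vec v"
        using v(3) \<open>Re z = 0\<close> B0 unfolding eigen_equation_real_imag by simp_all
      then have "Re_vec v = 0" "Im_vec v = 0"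
        using modes B0 avg0 unfolding only_synchronous_modes_def by blast+
      then show False using v(1) complex_vec_eq_iff[of v 0] by simp
    qed
    then show "0 < Re z" using Re_eigenvalue_nonneg(1)[OF v(3,1)] by simp
  qed
next
  assume E: ?E
  show only_synchronous_modes
    unfolding only_synchronous_modes_def
  proof (intro allI impI, rule ccontr)
    fix v :: "real^('q \<times> 'n)" and \<omega>
    assume v: "avg *v v = 0" "A *v v = \<omega> *\<^sub>R v" "B *v v = 0" "v \<noteq> 0"
    define w where "w = (\<chi> a. complex_of_real (v $ a))"
    have w: "Re_vec w = v" "Im_vec w = 0"
      by (simp_all add: w_def Re_vec_def Im_vec_def vec_eq_iff)
    have "\<Gamma> *v w = Complex 0 \<omega> *s w"
      unfolding eigen_equation_real_imag w by (simp add: v)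
    moreover have "map_matrix complex_of_real avg *v w = 0"
      by (simp add: complex_vec_eq_iff[of "_ *v _"] Re_Im_vec_mult_of_real w v)
    moreover have "w \<noteq> 0" using w v(4) by auto
    ultimately show False using E by fastforce
  qed
qed

text \<open>
  On the synchronous subspace the damping vanishes, so that its \<open>n\<close> eigenvalues, counted with
  multiplicity, all lie on the imaginary axis. Hence the eigenvalue number \<open>n + 1\<close> has positive real
  part iff all eigenvalues of \<open>\<Gamma>\<close> on the kernel of the average do.
\<close>

lemma Re_eigval_nth_Gamma_pos_iff:
  assumes "CARD('q) \<ge> 2"
  shows "0 < Re (eigval_nth (CARD('n) + 1) \<Gamma>) \<longleftrightarrow> only_synchronous_modes"
proof -
  let ?c = "map_matrix complex_of_real"
  fix i\<^sub>0 :: 'q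
  obtain Ti where "Ti ** (avg_coords i\<^sub>0 :: real^('q \<times> 'n)^('q \<times> 'n)) = mat 1"
    by (rule avg_coords_left_invertible)
  then have "?c (Ti ** (avg_coords i\<^sub>0 :: real^('q \<times> 'n)^('q \<times> 'n))) = ?c (mat 1)" by simp
  moreover have "?c (mat 1 :: real^('q \<times> 'n)^('q \<times> 'n)) = mat 1"
    by (simp add: vec_eq_iff mat_def)
  ultimately have Ti: "?c Ti ** ?c (avg_coords i\<^sub>0 :: real^('q \<times> 'n)^('q \<times> 'n)) = mat 1"
    by (simp only: map_matrix_of_real_mult)
  have "?c (avg_coords i\<^sub>0 ** (avg :: real^('q \<times> 'n)^('q \<times> 'n)))
      = (\<chi> a b. if a \<in> {i\<^sub>0} \<times> UNIV then ?c (avg_coords i\<^sub>0) $ a $ b else 0)"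
    unfolding avg_coords_avg by (simp add: vec_eq_iff)
  then have T: "?c (avg_coords i\<^sub>0) ** ?c (avg :: real^('q \<times> 'n)^('q \<times> 'n))
      = (\<chi> a b. if a \<in> {i\<^sub>0} \<times> UNIV then ?c (avg_coords i\<^sub>0) $ a $ b else 0)"
    by (simp only: map_matrix_of_real_mult)
  have "avg ** A = A ** avg" "avg ** B = B ** avg"
    by (simp_all add: matrix_eq avg_A avg_B flip: matrix_vector_mul_assoc)
  then have comm: "?c avg ** \<Gamma> = \<Gamma> ** ?c avg"
    by (simp only: matrix_add_ldistrib matrix_mult_add_rdistrib map_matrix_i_mult
        map_matrix_of_real_mult[symmetric])
  obtain p r where pr: "charpoly \<Gamma> = p * r" and deg: "degree p = card ({i\<^sub>0} \<times> (UNIV :: 'n set))"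
    and p: "\<forall>z. poly p z = 0 \<longleftrightarrow> (\<exists>v. v \<noteq> 0 \<and> ?c avg *v v = v \<and> \<Gamma> *v v = z *s v)"
    and r: "\<forall>z. poly r z = 0 \<longleftrightarrow> (\<exists>v. v \<noteq> 0 \<and> ?c avg *v v = 0 \<and> \<Gamma> *v v = z *s v)"
    by (rule charpoly_commuting_projection[OF comm Ti T]) (rule that; assumption)
  have "charpoly \<Gamma> \<noteq> 0" using degree_charpoly[of \<Gamma>] by auto
  then have ne: "p \<noteq> 0" "r \<noteq> 0" using pr by auto
  have "Re z = 0" if "poly p z = 0" for z
  proof -
    have "\<exists>v. v \<noteq> 0 \<and> ?c avg *v v = v \<and> \<Gamma> *v v = z *s v"
      using p[rule_format, THEN iffD1, OF that] .
    then obtain v where v: "v \<noteq> 0" "?c avg *v v = v" "\<Gamma> *v v = z *s v" by (elim exE conjE)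
    have "avg *v Re_vec v = Re_vec v" "avg *v Im_vec v = Im_vec v"
      using Re_Im_vec_mult_of_real[of avg v] v(2) by simp_all
    then have "B *v Re_vec v = 0" "B *v Im_vec v = 0" by (metis avg_B(2))+
    then show ?thesis using Re_eigenvalue_nonneg(2)[OF v(3,1)] by simp
  qed
  then have "{#z \<in># proots p. Re z \<le> 0#} = proots p"
    by (subst filter_mset_eq_conv) (auto simp: ne)
  then have "size {#z \<in># eigenvalues \<Gamma>. Re z \<le> 0#} = CARD('n) + size {#z \<in># proots r. Re z \<le> 0#}"
    by (simp add: eigenvalues_def pr proots_mult ne size_proots_complex deg card_cartesian_product)
  moreover have "CARD('n) < CARD('q \<times> 'n)" using assms by simp
  from Re_eigval_nth_pos_iff[OF this, of \<Gamma>]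
  have "0 < Re (eigval_nth (CARD('n) + 1) \<Gamma>) \<longleftrightarrow> size {#z \<in># eigenvalues \<Gamma>. Re z \<le> 0#} \<le> CARD('n)" .
  ultimately have "0 < Re (eigval_nth (CARD('n) + 1) \<Gamma>) \<longleftrightarrow> size {#z \<in># proots r. Re z \<le> 0#} = 0"
    by simp
  also have "\<dots> \<longleftrightarrow> (\<forall>z. poly r z = 0 \<longrightarrow> 0 < Re z)"
    by (auto simp: ne not_le)
  also have "\<dots> \<longleftrightarrow> only_synchronous_modes"
    unfolding only_synchronous_modes_iff_eigenvalues using r by blast
  finally show ?thesis .
qed

end

section \<open>From the array to the normalised network\<close>

lemma congruence_form:
  fixes H X :: "real^'n^'n"
  assumes "transpose H = H"
  shows "x \<bullet> ((H ** X ** H) *v y) = (H *v x) \<bullet> (X *v (H *v y))"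
  using symmetric_matrix_inner[OF assms] by (simp flip: matrix_vector_mul_assoc)

lemma transpose_congruence:
  fixes H X :: "real^'n^'n"
  assumes "transpose H = H" "transpose X = X"
  shows "transpose (H ** X ** H) = H ** X ** H"
  by (simp add: matrix_transpose_mul assms matrix_mul_assoc)

lemma sym_psd_congruence:
  fixes H X :: "real^'n^'n"
  assumes "transpose H = H" "sym_psd X"
  shows "sym_psd (H ** X ** H)"
  using assms by (simp add: sym_psd_def congruence_form transpose_congruence)

lemma sym_pd_congruence:
  fixes H X :: "real^'n^'n"
  assumes "transpose H = H" "sym_pd X" "\<And>x. H *v x = 0 \<Longrightarrow> x = 0"
  shows "sym_pd (H ** X ** H)"
  unfolding sym_pd_def
proof (intro conjI allI impI)
  show "transpose (H ** X ** H) = H ** X ** H"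
    using assms by (simp add: sym_pd_def transpose_congruence)
  fix x :: "real^'n" assume "x \<noteq> 0"
  then have "H *v x \<noteq> 0" using assms(3) by blast
  then show "0 < x \<bullet> ((H ** X ** H) *v x)"
    using assms by (simp add: sym_pd_def congruence_form)
qed

lemma has_vector_derivative_stack:
  fixes f :: "'q::finite \<Rightarrow> real \<Rightarrow> real^'n"
  assumes "\<And>i. (f i has_vector_derivative f' i) F"
  shows "((\<lambda>t. stack (\<lambda>i. f i t)) has_vector_derivative stack f') F"
proof -
  \<comment> \<open>\<open>J i\<close> embeds the vectors of node \<open>i\<close>.\<close>
  define J :: "'q \<Rightarrow> real^'n^('q \<times> 'n)" where "J i = (\<chi> a l. if a = (i, l) then 1 else 0)" for i
  have "stack g = (\<Sum>i\<in>UNIV. J i *v g i)" for g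
  proof -
    have "(\<Sum>i\<in>UNIV. J i *v g i) $ (j, k) = g j $ k" for j k
    proof -
      have "(J i *v g i) $ (j, k) = (if j = i then g i $ k else 0)" for i
        by (simp add: matrix_vector_mult_def J_def if_distrib if_distribR cong: if_cong)
      then show ?thesis by simp
    qed
    then show ?thesis by (simp add: vec_eq_iff stack_def)
  qed
  then show ?thesis
    by (simp add: has_vector_derivative_sum has_vector_derivative_matrix_vector_mult assms)
qed

lemma tendsto_blk:
  fixes f :: "'b \<Rightarrow> real^('q::finite \<times> 'n::finite)"
  assumes "(f \<longlongrightarrow> l) F"
  shows "((\<lambda>t. blk (f t) i) \<longlongrightarrow> blk l i) F"
  unfolding blk_def by (intro vec_tendstoI) (simp add: tendsto_vec_nth assms)


lemma blk_scaled_lap: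
  fixes W :: "'q::finite \<Rightarrow> 'q \<Rightarrow> real^'n^'n"
  assumes "\<And>i. W i i = 0"
  shows "blk (scaled_lap M W *v v) i
    = inv_sqrt M *v (\<Sum>j\<in>UNIV. W i j *v (inv_sqrt M *v blk v i - inv_sqrt M *v blk v j))"
proof -
  have "blk (scaled_lap M W *v v) i
      = (\<Sum>j\<in>UNIV. (inv_sqrt M ** W i j ** inv_sqrt M) *v (blk v i - blk v j))"
    unfolding scaled_lap_def by (rule blk_lap) (simp add: assms)
  then show ?thesis
    by (simp add: matrix_vector_mult_sum matrix_vector_mult_diff_distrib flip: matrix_vector_mul_assoc)
qed

text \<open>
  Multiplying the equation of node \<open>i\<close> by the invertible matrix \<open>H\<close> and substituting \<open>H b\<close>, \<open>H c\<close>, \<open>H a\<close> for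
  its position, velocity and acceleration gives block \<open>i\<close> of the normalised equation.
\<close>

lemma array_equation_scaled:
  fixes M K :: "real^'n^'n" and D R :: "'q::finite \<Rightarrow> 'q \<Rightarrow> real^'n^'n"
  defines "H \<equiv> inv_sqrt M"
  assumes M: "sym_pd M" and "\<And>i. D i i = 0" and "\<And>i. R i i = 0"
  shows "(\<forall>i. M *v (H *v blk a i) + K *v (H *v blk b i)
        + (\<Sum>j\<in>UNIV. D i j *v (H *v blk c i - H *v blk c j))
        + (\<Sum>j\<in>UNIV. R i j *v (H *v blk b i - H *v blk b j)) = 0) \<longleftrightarrow>
    a + (kronecker (mat 1 :: real^'q^'q) (P_mat M K) + scaled_lap M R) *v b + scaled_lap M D *v c = 0"
    (is "(\<forall>i. ?E i = 0) \<longleftrightarrow> ?rhs = 0")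
proof -
  have HMH: "H *v (M *v (H *v u)) = u" for u
  proof -
    have "H *v (M *v (H *v u)) = (H ** M ** H) *v u"
      by (simp add: matrix_vector_mul_assoc matrix_mul_assoc)
    then show ?thesis by (simp add: H_def inv_sqrt_congruence[OF M])
  qed
  have HKH: "P_mat M K *v u = H *v (K *v (H *v u))" for u
    by (simp add: P_mat_def H_def matrix_vector_mul_assoc matrix_mul_assoc)
  have scaled: "H *v ?E i = blk ?rhs i" for i
  proof -
    have "blk ?rhs i = blk a i + (H *v (K *v (H *v blk b i))
        + H *v (\<Sum>j\<in>UNIV. R i j *v (H *v blk b i - H *v blk b j)))
        + H *v (\<Sum>j\<in>UNIV. D i j *v (H *v blk c i - H *v blk c j))"
      by (simp only: blk_linear matrix_vector_mult_add_rdistrib blk_kronecker_mat_1 HKH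
          blk_scaled_lap[of D, OF assms(3)] blk_scaled_lap[of R, OF assms(4)] H_def)
    then show ?thesis by (simp only: matrix_vector_right_distrib HMH add_ac)
  qed
  have H0: "H *v w = 0 \<longleftrightarrow> w = 0" for w
  proof
    have "matrix_sqrt M *v (H *v w) = w"
      by (simp add: matrix_vector_mul_assoc H_def matrix_sqrt_inv_sqrt[OF M])
    then show "w = 0" if "H *v w = 0" using that by simp
  qed simp
  have "?E i = 0 \<longleftrightarrow> blk ?rhs i = 0" for i
    using H0[of "?E i"] by (simp only: scaled)
  moreover have "?rhs = 0 \<longleftrightarrow> (\<forall>i. blk ?rhs i = 0)"
    by (rule vec_eq_0_iff_blk)
  ultimately show ?thesis by simp
qed

theorem theorem1:
  fixes M K :: "real^'n^'n"
    and D R :: "'q::finite \<Rightarrow> 'q \<Rightarrow> real^'n^'n"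
  assumes "CARD('q) \<ge> 2"
    and "sym_pd M" and "sym_pd K"
    and "\<And>i j. sym_psd (D i j)" and "\<And>i j. D i j = D j i" and "\<And>i. D i i = 0"
    and "\<And>i j. sym_psd (R i j)" and "\<And>i j. R i j = R j i" and "\<And>i. R i i = 0"
    and "card (set_mset (eigenvalues (P_mat M K))) = CARD('n)"
  shows "synchronizes M K D R \<longleftrightarrow> Re (eigval_nth (CARD('n) + 1) (Gamma_mat M K D R)) > 0"
proof -
  let ?H = "inv_sqrt M" and ?S = "matrix_sqrt M"
  note M = assms(2)
  have HS: "?H *v (?S *v u) = u" and SH: "?S *v (?H *v u) = u" for u
    using matrix_sqrt_inv_sqrt[OF M] by (simp_all add: matrix_vector_mul_assoc)
  have H0: "u = 0" if "?H *v u = 0" for u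
    using SH[of u] that by simp
  have symH: "transpose ?H = ?H" by (rule inv_sqrt_symmetric[OF M])
  interpret N: scaled_network "P_mat M K" "\<lambda>i j. ?H ** D i j ** ?H" "\<lambda>i j. ?H ** R i j ** ?H"
  proof
    show "sym_pd (P_mat M K)"
      unfolding P_mat_def using symH assms(3) H0 by (rule sym_pd_congruence)
    show "sym_psd (?H ** D i j ** ?H)" "sym_psd (?H ** R i j ** ?H)" for i j
      using symH assms(4,7) by (auto intro: sym_psd_congruence)
    show "?H ** D i j ** ?H = ?H ** D j i ** ?H" "?H ** R i j ** ?H = ?H ** R j i ** ?H" for i j
      by (simp_all only: assms(5)[of i j] assms(8)[of i j])
    show "?H ** D i i ** ?H = 0" "?H ** R i i ** ?H = 0" for i
      by (simp_all add: assms(6,9))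
  qed
  have equation: "(\<forall>i. M *v (?H *v blk a i) + K *v (?H *v blk b i)
        + (\<Sum>j\<in>UNIV. D i j *v (?H *v blk c i - ?H *v blk c j))
        + (\<Sum>j\<in>UNIV. R i j *v (?H *v blk b i - ?H *v blk b j)) = 0)
      \<longleftrightarrow> a + N.A *v b + N.B *v c = 0" for a b c
    using array_equation_scaled[OF M, of D R] assms(6,9) by (simp only: scaled_lap_def)
  have "synchronizes M K D R \<longleftrightarrow> N.only_synchronous_modes"
  proof
    assume modes: "N.only_synchronous_modes"
    show "synchronizes M K D R"
      unfolding synchronizes_def
    proof (intro allI impI)
      fix x i j assume "array_solution M K D R x"
      then obtain x' x'' where dx: "\<And>t i. 0 \<le> t \<Longrightarrow> (x i has_vector_derivative x' i t) (at t within {0..})"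
        and dx': "\<And>t i. 0 \<le> t \<Longrightarrow> (x' i has_vector_derivative x'' i t) (at t within {0..})"
        and eq: "\<And>t i. 0 \<le> t \<Longrightarrow> M *v x'' i t + K *v x i t
          + (\<Sum>j\<in>UNIV. D i j *v (x' i t - x' j t)) + (\<Sum>j\<in>UNIV. R i j *v (x i t - x j t)) = 0"
        unfolding array_solution_def by blast
      define y where "y t = stack (\<lambda>i. ?S *v x i t)" for t
      define y' where "y' t = stack (\<lambda>i. ?S *v x' i t)" for t
      define y'' where "y'' t = stack (\<lambda>i. ?S *v x'' i t)" for t
      have dy: "(y has_vector_derivative y' t) (at t within {0..})" if "0 \<le> t" for t
        unfolding y_def[abs_def] y'_def
        by (intro has_vector_derivative_stack has_vector_derivative_matrix_vector_mult dx that)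
      have dy': "(y' has_vector_derivative - (N.A *v y t) - N.B *v y' t) (at t within {0..})"
        if "0 \<le> t" for t
      proof -
        have "(y' has_vector_derivative y'' t) (at t within {0..})"
          unfolding y'_def[abs_def] y''_def
          by (intro has_vector_derivative_stack has_vector_derivative_matrix_vector_mult dx' that)
        moreover have "y'' t + N.A *v y t + N.B *v y' t = 0"
          unfolding equation[symmetric] by (simp add: y_def y'_def y''_def HS eq[OF that])
        then have "y'' t + N.A *v y t = - (N.B *v y' t)"
          by (simp only: eq_neg_iff_add_eq_0)
        then have "y'' t = - (N.B *v y' t) - N.A *v y t"
          by (simp only: eq_diff_eq)
        then have "y'' t = - (N.A *v y t) - N.B *v y' t"
          by (simp only: diff_conv_add_uminus add.commute)
        ultimately show ?thesis by simp
      qed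
      define z where "z t = y t - avg *v y t" for t
      have "(z \<longlongrightarrow> 0) at_top"
        unfolding z_def[abs_def] using modes dy dy' by (rule N.deviation_tendsto_0)
      then have "((\<lambda>t. ?H *v (blk (z t) i - blk (z t) j)) \<longlongrightarrow> ?H *v (blk 0 i - blk 0 j)) at_top"
        by (intro tendsto_matrix_vector_mult tendsto_diff tendsto_blk)
      moreover have "?H *v (blk (z t) i - blk (z t) j) = x i t - x j t" for t
        by (simp add: z_def blk_avg) (simp add: y_def matrix_vector_mult_diff_distrib HS)
      ultimately show "((\<lambda>t. norm (x i t - x j t)) \<longlongrightarrow> 0) at_top"
        by (simp add: tendsto_norm_zero_iff)
    qed
  next
    assume sync: "synchronizes M K D R"
    show "N.only_synchronous_modes"
      unfolding N.only_synchronous_modes_def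
    proof (intro allI impI, rule ccontr)
      fix v :: "real^('q \<times> 'n)" and \<omega>
      assume v: "avg *v v = 0" "N.A *v v = \<omega> *\<^sub>R v" "N.B *v v = 0" "v \<noteq> 0"
      have "0 < \<omega> * (v \<bullet> v)"
        using N.sym_pd_A v(2,4) unfolding sym_pd_def by (metis inner_scaleR_right)
      then have "0 < \<omega>" using inner_ge_zero[of v] by (auto simp: zero_less_mult_iff)
      define s where "s = sqrt \<omega>"
      have s: "0 < s" "s * s = \<omega>" using \<open>0 < \<omega>\<close> by (simp_all add: s_def)
      \<comment> \<open>An undamped mode oscillates forever.\<close>
      define x where "x i t = cos (s * t) *\<^sub>R (?H *v blk v i)" for i t
      have "array_solution M K D R x"
        unfolding array_solution_def
      proof (intro exI allI impI conjI)
        fix t :: real and i :: 'q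
        have dcos: "((\<lambda>t. cos (s * t)) has_real_derivative - s * sin (s * t)) (at t within {0..})"
          by (auto intro!: derivative_eq_intros)
        have dsin: "((\<lambda>t. - s * sin (s * t)) has_real_derivative - \<omega> * cos (s * t)) (at t within {0..})"
          by (auto intro!: derivative_eq_intros simp: s(2)[symmetric])
        show "(x i has_vector_derivative (- s * sin (s * t)) *\<^sub>R (?H *v blk v i)) (at t within {0..})"
          unfolding x_def[abs_def] using dcos
          by (intro bounded_linear.has_vector_derivative[OF bounded_linear_scaleR_left])
            (simp add: has_real_derivative_iff_has_vector_derivative)
        show "((\<lambda>t. (- s * sin (s * t)) *\<^sub>R (?H *v blk v i)) has_vector_derivative
            (- \<omega> * cos (s * t)) *\<^sub>R (?H *v blk v i)) (at t within {0..})"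
          using dsin by (intro bounded_linear.has_vector_derivative[OF bounded_linear_scaleR_left])
            (simp add: has_real_derivative_iff_has_vector_derivative)
        let ?a = "(- \<omega> * cos (s * t)) *\<^sub>R v" and ?b = "cos (s * t) *\<^sub>R v" and ?c = "(- s * sin (s * t)) *\<^sub>R v"
        have "?a + N.A *v ?b + N.B *v ?c = 0"
          unfolding matrix_vector_mult_scaleR v by simp
        from equation[THEN iffD2, OF this, rule_format, of i]
        show "M *v ((- \<omega> * cos (s * t)) *\<^sub>R (?H *v blk v i)) + K *v x i t
          + (\<Sum>j\<in>UNIV. D i j *v ((- s * sin (s * t)) *\<^sub>R (?H *v blk v i)
              - (- s * sin (s * t)) *\<^sub>R (?H *v blk v j)))
          + (\<Sum>j\<in>UNIV. R i j *v (x i t - x j t)) = 0"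
          unfolding x_def blk_linear matrix_vector_mult_scaleR[of ?H] .
      qed
      then have lim: "((\<lambda>t. norm (x i t - x j t)) \<longlongrightarrow> 0) at_top" for i j
        using sync unfolding synchronizes_def by blast
      have eq: "blk v i = blk v j" for i j
      proof -
        \<comment> \<open>After full periods the oscillation is back at its initial position.\<close>
        define \<tau> where "\<tau> k = 2 * pi / s * real k" for k
        have "filterlim \<tau> at_top sequentially"
          unfolding \<tau>_def[abs_def] using s(1)
          by (intro filterlim_tendsto_pos_mult_at_top[OF tendsto_const _ filterlim_real_sequentially]) simp
        from filterlim_compose[OF lim[of i j] this]
        have "(\<lambda>k. norm (x i (\<tau> k) - x j (\<tau> k))) \<longlonglongrightarrow> 0" .
        moreover have "cos (s * \<tau> k) = 1" for k
        proof -
          have "s * \<tau> k = 2 * real k * pi" using s(1) by (simp add: \<tau>_def)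
          then show ?thesis by (simp only: cos_2npi)
        qed
        ultimately have "norm (?H *v blk v i - ?H *v blk v j) = 0"
          by (simp add: x_def LIMSEQ_const_iff)
        then have "?H *v (blk v i - blk v j) = 0"
          by (simp add: matrix_vector_mult_diff_distrib)
        from H0[OF this] show ?thesis by simp
      qed
      have "blk (avg *v v) i = blk v i" for i
      proof -
        have "(\<Sum>j\<in>UNIV. blk v j) = (\<Sum>j\<in>(UNIV::'q set). blk v i)"
          by (intro sum.cong refl eq)
        then show ?thesis unfolding blk_avg by (simp add: sum_constant_scaleR del: sum_constant)
      qed
      then have "avg *v v = v" by (rule vec_eq_blkI)
      then show False using v(1,4) by simp
    qed
  qed
  also have "\<dots> \<longleftrightarrow> 0 < Re (eigval_nth (CARD('n) + 1) N.\<Gamma>)"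
    using N.Re_eigval_nth_Gamma_pos_iff[OF assms(1)] by simp
  also have "N.\<Gamma> = Gamma_mat M K D R"
    by (simp only: Gamma_mat_def scaled_lap_def)
  finally show ?thesis .
qed

end
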